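(* Let $(X,\sigma)$ be a connected Klein surface, let $x\in X$, and let $p:(\widetilde X,\tilde x)\to(X,x)$ be a universal cover of $X$. Let $V$ be a finite-dimensional complex vector space with a Hermitian metric $h$ and a compatible linear real structure $\alpha$. Set $$\mathcal R:=\mathrm{Hom}(\pi_1(X;x);\mathbf U(V))/\mathbf U(V),\qquad\mathcal R(\sigma,\alpha):=\mathrm{Hom}_{\mathbb Z/2\mathbb Z}\big(\pi_1^{\mathbb R}((X,\sigma);x);\mathbf U(V)\rtimes_\alpha\mathbb Z/2\mathbb Z\big)/\mathbf U(V),$$ and let $\kappa:\mathcal R\to\mathcal R$ be the involution $[\rho]\mapsto[\mathrm{Ad}_\alpha\circ\rho\circ\mathrm{Ad}_{\tilde\sigma}^{-1}]$, where $\tilde\sigma$ is any element of $\pi_1^{\mathbb R}((X,\sigma);x)\setminus\pi_1(X;x)$. Then the map $$\Phi:\mathcal R(\sigma,\alpha)\to\mathcal R,\qquad[\rho]\mapsto[\rho|_{\pi_1(X;x)}],$$ sends $\mathcal R(\sigma,\alpha)$ to points of $\mathrm{Fix}(\kappa)\subset\mathcal R$. It is not surjective onto $\mathrm{Fix}(\kappa)$ in general, i.e. there exist choices of $(X,\sigma)$, $x$ and $(V,h,\alpha)$ for which the image of $\Phi$ is a proper subset of $\mathrm{Fix}(\kappa)$.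
   Context: A (connected) Klein surface $(X,\sigma)$ is a connected Riemann surface $X$ (without boundary) together with an anti-holomorphic involution $\sigma:X\to X$. A universal cover $p:(\widetilde X,\tilde x)\to(X,x)$ is a simply connected (connected) pointed topological covering, with the unique complex structure on $\widetilde X$ making $p$ holomorphic. The fundamental group of $(X,\sigma)$ is $$\pi_1^{\mathbb R}((X,\sigma);x):=\{f:\widetilde X\to\widetilde X\text{ self-diffeomorphism}\mid\exists\,\sigma_f\in\{\mathrm{Id}_X,\sigma\},\ p\circ f=\sigma_f\circ p\}$$ with group law $f\cdot g:=g\circ f$ (the opposite of composition). The topological fundamental group $\pi_1(X;x):=\mathrm{Aut}(\widetilde X/X)^{\mathrm{op}}$ is its normal subgroup of elements with $p\circ f=p$, which is the kernel of the surjective augmentation homomorphism $\pi_1^{\mathbb R}((X,\sigma);x)\to\{\mathrm{Id}_X,\sigma\}\simeq\mathbb Z/2\mathbb Z$, $f\mapsto\sigma_f$. A linear real structure on $V$ is a $\mathbb C$-anti-linear map $\alpha:V\to V$ with $\alpha^2=\mathrm{Id}_V$; it is compatible with $h$ if it is an (anti-linear) isometry: $h(\alpha v,\alpha w)=\overline{h(v,w)}$. $\mathbf U(V)$ is the unitary group of $(V,h)$. $\mathbf U(V)\rtimes_\alpha\mathbb Z/2\mathbb Z$ is the semi-direct product in which $\mathbb Z/2\mathbb Z\simeq\{\mathrm{Id}_V,\alpha\}$ acts on $\mathbf U(V)$ by $\mathrm{Ad}_\alpha u:=\alpha\circ u\circ\alpha^{-1}$; it is identified with the group $\mathbf U^\pm(V)$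 of $\mathbb C$-linear and $\mathbb C$-anti-linear isometries of $(V,h)$, and has the augmentation map to $\mathbb Z/2\mathbb Z$ with kernel $\mathbf U(V)$. $\mathrm{Hom}_{\mathbb Z/2\mathbb Z}(A;B)$ denotes the set of group homomorphisms $A\to B$ commuting with the given augmentation maps $A\to\mathbb Z/2\mathbb Z$ and $B\to\mathbb Z/2\mathbb Z$. In both $\mathcal R$ and $\mathcal R(\sigma,\alpha)$, $\mathbf U(V)$ acts by conjugation, $u\cdot\rho=\mathrm{Ad}_u\circ\rho$ with $\mathrm{Ad}_u(g)=ugu^{-1}$, and $[\rho]$ denotes the orbit of $\rho$. For $\tilde\sigma\in\pi_1^{\mathbb R}((X,\sigma);x)\setminus\pi_1(X;x)$, $\mathrm{Ad}_{\tilde\sigma}^{-1}$ is the automorphism $f\mapsto\tilde\sigma^{-1}f\tilde\sigma$ of $\pi_1(X;x)$ (products in $\pi_1^{\mathbb R}((X,\sigma);x)$). The map $\kappa$ is a well-defined involution, independent of the choice of $\tilde\sigma$. *)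

theory Defs
  imports
    "HOL-Analysis.Analysis"
    "HOL-Algebra.Bij"
    "HOL-Algebra.Group_Action"
    "HOL-Algebra.Elementary_Groups"
begin

section \<open>Riemann surfaces, Klein surfaces, universal covers\<close>

text \<open>The underlying space of a surface is a set \<open>X\<close> in a topological type, with the subspace
  topology. A complex atlas is a set of charts \<open>(U, \<phi>)\<close>; only the values of \<open>\<phi>\<close> on \<open>U\<close>
  matter. Atlases are not required to be maximal: the notions of map below do not change when an
  atlas is replaced by an equivalent one. Second countability is not required; for connected
  Riemann surfaces it is automatic (Rado).\<close>

type_synonym 'a chart = "'a set \<times> ('a \<Rightarrow> complex)"

definition complex_atlas :: "'a::topological_space set \<Rightarrow> 'a chart set \<Rightarrow> bool" where
  "complex_atlas X A \<longleftrightarrow>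
     (\<forall>(U, \<phi>) \<in> A. openin (top_of_set X) U \<and> open (\<phi> ` U) \<and> (\<exists>\<psi>. homeomorphism U (\<phi> ` U) \<phi> \<psi>)) \<and>
     (\<Union>(U, \<phi>) \<in> A. U) = X \<and>
     (\<forall>(U, \<phi>) \<in> A. \<forall>(W, \<psi>) \<in> A. (\<psi> \<circ> inv_into U \<phi>) holomorphic_on (\<phi> ` (U \<inter> W)))"

definition riemann_surface :: "'a::topological_space set \<Rightarrow> 'a chart set \<Rightarrow> bool" where
  "riemann_surface X A \<longleftrightarrow> Hausdorff_space (top_of_set X) \<and> complex_atlas X A"

text \<open>Continuous maps all of whose expressions in charts have a local property \<open>P\<close>. The domain
  \<open>\<phi> ` (U \<inter> f -` W)\<close> of such an expression is open in the plane, as \<open>f\<close> is continuous.\<close>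

definition map_in_charts ::
  "(complex set \<Rightarrow> (complex \<Rightarrow> complex) \<Rightarrow> bool) \<Rightarrow>
   'a::topological_space set \<Rightarrow> 'a chart set \<Rightarrow>
   'b::topological_space set \<Rightarrow> 'b chart set \<Rightarrow> ('a \<Rightarrow> 'b) \<Rightarrow> bool" where
  "map_in_charts P X A Y B f \<longleftrightarrow>
     continuous_on X f \<and> f ` X \<subseteq> Y \<and>
     (\<forall>(U, \<phi>) \<in> A. \<forall>(W, \<psi>) \<in> B. P (\<phi> ` (U \<inter> f -` W)) (\<psi> \<circ> f \<circ> inv_into U \<phi>))"

definition holomorphic_map ::
  "'a::topological_space set \<Rightarrow> 'a chart set \<Rightarrow>
   'b::topological_space set \<Rightarrow> 'b chart set \<Rightarrow> ('a \<Rightarrow> 'b) \<Rightarrow> bool" where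
  "holomorphic_map = map_in_charts (\<lambda>S g. g holomorphic_on S)"

definition antiholomorphic_map ::
  "'a::topological_space set \<Rightarrow> 'a chart set \<Rightarrow>
   'b::topological_space set \<Rightarrow> 'b chart set \<Rightarrow> ('a \<Rightarrow> 'b) \<Rightarrow> bool" where
  "antiholomorphic_map = map_in_charts (\<lambda>S g. (\<lambda>z. cnj (g z)) holomorphic_on S)"

text \<open>\<open>Ck_on k f S\<close>, for \<open>S\<close> open: \<open>f\<close> is \<open>k\<close> times continuously differentiable on \<open>S\<close> in the real
  sense, i.e. differentiable with all its directional derivatives of class \<open>C\<^sup>k\<^sup>-\<^sup>1\<close>.\<close>

primrec Ck_on ::
  "nat \<Rightarrow> ('a::euclidean_space \<Rightarrow> 'b::real_normed_vector) \<Rightarrow> 'a set \<Rightarrow> bool" where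
  "Ck_on 0 f S \<longleftrightarrow> continuous_on S f"
| "Ck_on (Suc k) f S \<longleftrightarrow>
     (\<forall>z\<in>S. f differentiable (at z)) \<and> (\<forall>v. Ck_on k (\<lambda>z. frechet_derivative f (at z) v) S)"

definition smooth_map ::
  "'a::topological_space set \<Rightarrow> 'a chart set \<Rightarrow>
   'b::topological_space set \<Rightarrow> 'b chart set \<Rightarrow> ('a \<Rightarrow> 'b) \<Rightarrow> bool" where
  "smooth_map = map_in_charts (\<lambda>S g. \<forall>k. Ck_on k g S)"

definition connected_klein_surface ::
  "'a::topological_space set \<Rightarrow> 'a chart set \<Rightarrow> ('a \<Rightarrow> 'a) \<Rightarrow> bool" where
  "connected_klein_surface X A \<sigma> \<longleftrightarrow>
     riemann_surface X A \<and> connected X \<and> antiholomorphic_map X A X A \<sigma> \<and> (\<forall>y\<in>X. \<sigma> (\<sigma> y) = y)"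

text \<open>The atlas \<open>At\<close> of the cover \<open>Xt\<close> is, up to equivalence, determined by the holomorphy of \<open>p\<close>.\<close>

definition universal_cover ::
  "'b::topological_space set \<Rightarrow> 'b chart set \<Rightarrow> 'b \<Rightarrow> ('b \<Rightarrow> 'a) \<Rightarrow>
   'a::topological_space set \<Rightarrow> 'a chart set \<Rightarrow> 'a \<Rightarrow> bool" where
  "universal_cover Xt At xt p X A x \<longleftrightarrow>
     covering_space Xt p X \<and> simply_connected Xt \<and> xt \<in> Xt \<and> p xt = x \<and>
     riemann_surface Xt At \<and> holomorphic_map Xt At X A p"


section \<open>Fundamental groups\<close>

text \<open>As in \<^const>\<open>Bij\<close>, self-maps of \<open>Xt\<close> are taken to be undefined outside \<open>Xt\<close>.\<close>

definition self_diffeos :: "'b::topological_space set \<Rightarrow> 'b chart set \<Rightarrow> ('b \<Rightarrow> 'b) set" where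
  "self_diffeos Xt At =
     {f \<in> Bij Xt. smooth_map Xt At Xt At f \<and> smooth_map Xt At Xt At (inv_into Xt f)}"

definition opposite :: "('g, 'm) monoid_scheme \<Rightarrow> ('g, 'm) monoid_scheme" where
  "opposite G = G\<lparr>monoid.mult := \<lambda>f g. g \<otimes>\<^bsub>G\<^esub> f\<rparr>"

definition real_fundamental_group ::
  "'b::topological_space set \<Rightarrow> 'b chart set \<Rightarrow> ('b \<Rightarrow> 'a) \<Rightarrow> ('a \<Rightarrow> 'a) \<Rightarrow> ('b \<Rightarrow> 'b) monoid" where
  "real_fundamental_group Xt At p \<sigma> =
     (opposite (BijGroup Xt))
       \<lparr>carrier := {f \<in> self_diffeos Xt At. \<exists>s\<in>{id, \<sigma>}. \<forall>y\<in>Xt. p (f y) = s (p y)}\<rparr>"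

text \<open>Deck transformations are automatically diffeomorphisms, so this is the opposite of the
  automorphism group of the covering.\<close>

definition fundamental_group ::
  "'b::topological_space set \<Rightarrow> 'b chart set \<Rightarrow> ('b \<Rightarrow> 'a) \<Rightarrow> ('b \<Rightarrow> 'b) monoid" where
  "fundamental_group Xt At p =
     (opposite (BijGroup Xt))\<lparr>carrier := {f \<in> self_diffeos Xt At. \<forall>y\<in>Xt. p (f y) = p y}\<rparr>"

text \<open>The augmentation \<open>f \<mapsto> \<sigma>\<^sub>f\<close>, with \<open>Id\<close> and \<open>\<sigma>\<close> written as the elements \<open>0\<close> and \<open>1\<close> of
  \<open>integer_mod_group 2\<close>.\<close>

definition deck_aug :: "'b set \<Rightarrow> ('b \<Rightarrow> 'a) \<Rightarrow> ('b \<Rightarrow> 'b) \<Rightarrow> int" where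
  "deck_aug Xt p f = (if \<forall>y\<in>Xt. p (f y) = p y then 0 else 1)"


section \<open>Hermitian spaces, real structures, unitary groups\<close>

text \<open>\<open>V\<close> is the whole type \<open>'v\<close> with complex scalar multiplication \<open>smul\<close>; the metric is linear in
  the first variable, hence conjugate-linear in the second.\<close>

definition hermitian_space ::
  "(complex \<Rightarrow> 'v \<Rightarrow> 'v::ab_group_add) \<Rightarrow> ('v \<Rightarrow> 'v \<Rightarrow> complex) \<Rightarrow> bool" where
  "hermitian_space smul h \<longleftrightarrow>
     (\<exists>B. finite_dimensional_vector_space smul B) \<and>
     (\<forall>u v w. h (u + v) w = h u w + h v w) \<and>
     (\<forall>c v w. h (smul c v) w = c * h v w) \<and>
     (\<forall>v w. h w v = cnj (h v w)) \<and>
     (\<forall>v. v \<noteq> 0 \<longrightarrow> Re (h v v) > 0)"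

definition compatible_real_structure ::
  "(complex \<Rightarrow> 'v \<Rightarrow> 'v::ab_group_add) \<Rightarrow> ('v \<Rightarrow> 'v \<Rightarrow> complex) \<Rightarrow> ('v \<Rightarrow> 'v) \<Rightarrow> bool" where
  "compatible_real_structure smul h \<alpha> \<longleftrightarrow>
     (\<forall>v w. \<alpha> (v + w) = \<alpha> v + \<alpha> w) \<and>
     (\<forall>c v. \<alpha> (smul c v) = smul (cnj c) (\<alpha> v)) \<and>
     (\<forall>v. \<alpha> (\<alpha> v) = v) \<and>
     (\<forall>v w. h (\<alpha> v) (\<alpha> w) = cnj (h v w))"

definition unitary_group ::
  "(complex \<Rightarrow> 'v \<Rightarrow> 'v::ab_group_add) \<Rightarrow> ('v \<Rightarrow> 'v \<Rightarrow> complex) \<Rightarrow> ('v \<Rightarrow> 'v) monoid" where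
  "unitary_group smul h =
     \<lparr>carrier = {u. Vector_Spaces.linear smul smul u \<and> bij u \<and> (\<forall>v w. h (u v) (u w) = h v w)},
      monoid.mult = (\<circ>), one = id\<rparr>"

definition semidirect_product ::
  "('n, 'x) monoid_scheme \<Rightarrow> ('h, 'y) monoid_scheme \<Rightarrow> ('h \<Rightarrow> 'n \<Rightarrow> 'n) \<Rightarrow> ('n \<times> 'h) monoid" where
  "semidirect_product N H \<theta> =
     \<lparr>carrier = carrier N \<times> carrier H,
      monoid.mult = (\<lambda>(u, a) (v, b). (u \<otimes>\<^bsub>N\<^esub> \<theta> a v, a \<otimes>\<^bsub>H\<^esub> b)),
      one = (\<one>\<^bsub>N\<^esub>, \<one>\<^bsub>H\<^esub>)\<rparr>"

definition Ad_real :: "('v \<Rightarrow> 'v) \<Rightarrow> ('v \<Rightarrow> 'v) \<Rightarrow> ('v \<Rightarrow> 'v)" where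
  "Ad_real \<alpha> u = \<alpha> \<circ> u \<circ> inv_into UNIV \<alpha>"

text \<open>The pair \<open>(u, 0)\<close> stands for \<open>u\<close>, and \<open>(u, 1)\<close> for \<open>u \<circ> \<alpha>\<close>; the augmentation is \<^const>\<open>snd\<close>.\<close>

definition unitary_semidirect ::
  "(complex \<Rightarrow> 'v \<Rightarrow> 'v::ab_group_add) \<Rightarrow> ('v \<Rightarrow> 'v \<Rightarrow> complex) \<Rightarrow> ('v \<Rightarrow> 'v) \<Rightarrow>
   (('v \<Rightarrow> 'v) \<times> int) monoid" where
  "unitary_semidirect smul h \<alpha> =
     semidirect_product (unitary_group smul h) (integer_mod_group 2)
       (\<lambda>a. if a = 0 then id else Ad_real \<alpha>)"


section \<open>Representation spaces\<close>

text \<open>Homomorphisms are taken to be undefined outside the carrier, so that homomorphisms that agree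
  on the carrier are equal.\<close>

definition Hom :: "('g, 'x) monoid_scheme \<Rightarrow> ('h, 'y) monoid_scheme \<Rightarrow> ('g \<Rightarrow> 'h) set" where
  "Hom G H = hom G H \<inter> extensional (carrier G)"

definition Hom_aug ::
  "('g, 'x) monoid_scheme \<Rightarrow> ('g \<Rightarrow> int) \<Rightarrow> ('h, 'y) monoid_scheme \<Rightarrow> ('h \<Rightarrow> int) \<Rightarrow> ('g \<Rightarrow> 'h) set" where
  "Hom_aug G a H b = {\<rho> \<in> Hom G H. \<forall>g\<in>carrier G. b (\<rho> g) = a g}"

definition conj_hom ::
  "('g, 'x) monoid_scheme \<Rightarrow> ('h, 'y) monoid_scheme \<Rightarrow> 'h \<Rightarrow> ('g \<Rightarrow> 'h) \<Rightarrow> ('g \<Rightarrow> 'h)" where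
  "conj_hom G H u \<rho> = (\<lambda>g\<in>carrier G. u \<otimes>\<^bsub>H\<^esub> \<rho> g \<otimes>\<^bsub>H\<^esub> inv\<^bsub>H\<^esub> u)"

text \<open>The class \<open>[\<rho>]\<close> of \<open>\<rho>\<close> in \<open>\<R>\<close>.\<close>

definition rep_class ::
  "'b::topological_space set \<Rightarrow> 'b chart set \<Rightarrow> ('b \<Rightarrow> 'a) \<Rightarrow>
   (complex \<Rightarrow> 'v \<Rightarrow> 'v::ab_group_add) \<Rightarrow> ('v \<Rightarrow> 'v \<Rightarrow> complex) \<Rightarrow>
   (('b \<Rightarrow> 'b) \<Rightarrow> ('v \<Rightarrow> 'v)) \<Rightarrow> (('b \<Rightarrow> 'b) \<Rightarrow> ('v \<Rightarrow> 'v)) set" where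
  "rep_class Xt At p smul h =
     orbit (unitary_group smul h) (conj_hom (fundamental_group Xt At p) (unitary_group smul h))"

definition rep_space ::
  "'b::topological_space set \<Rightarrow> 'b chart set \<Rightarrow> ('b \<Rightarrow> 'a) \<Rightarrow>
   (complex \<Rightarrow> 'v \<Rightarrow> 'v::ab_group_add) \<Rightarrow> ('v \<Rightarrow> 'v \<Rightarrow> complex) \<Rightarrow>
   (('b \<Rightarrow> 'b) \<Rightarrow> ('v \<Rightarrow> 'v)) set set" where
  "rep_space Xt At p smul h =
     orbits (unitary_group smul h)
       (Hom (fundamental_group Xt At p) (unitary_group smul h))
       (conj_hom (fundamental_group Xt At p) (unitary_group smul h))"

definition real_rep_space ::
  "'b::topological_space set \<Rightarrow> 'b chart set \<Rightarrow> ('b \<Rightarrow> 'a) \<Rightarrow> ('a \<Rightarrow> 'a) \<Rightarrow>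
   (complex \<Rightarrow> 'v \<Rightarrow> 'v::ab_group_add) \<Rightarrow> ('v \<Rightarrow> 'v \<Rightarrow> complex) \<Rightarrow> ('v \<Rightarrow> 'v) \<Rightarrow>
   (('b \<Rightarrow> 'b) \<Rightarrow> ('v \<Rightarrow> 'v) \<times> int) set set" where
  "real_rep_space Xt At p \<sigma> smul h \<alpha> =
     orbits (unitary_group smul h)
       (Hom_aug (real_fundamental_group Xt At p \<sigma>) (deck_aug Xt p)
          (unitary_semidirect smul h \<alpha>) snd)
       (\<lambda>u. conj_hom (real_fundamental_group Xt At p \<sigma>) (unitary_semidirect smul h \<alpha>) (u, 0))"

text \<open>Maps between orbit spaces are given by taking the union of the classes of the images of all
  representatives; these classes coincide. In \<open>\<Phi>\<close>, the kernel of the augmentation of the semidirect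
  product is identified with the unitary group by \<^const>\<open>fst\<close>.\<close>

definition Phi_map ::
  "'b::topological_space set \<Rightarrow> 'b chart set \<Rightarrow> ('b \<Rightarrow> 'a) \<Rightarrow>
   (complex \<Rightarrow> 'v \<Rightarrow> 'v::ab_group_add) \<Rightarrow> ('v \<Rightarrow> 'v \<Rightarrow> complex) \<Rightarrow>
   (('b \<Rightarrow> 'b) \<Rightarrow> ('v \<Rightarrow> 'v) \<times> int) set \<Rightarrow> (('b \<Rightarrow> 'b) \<Rightarrow> ('v \<Rightarrow> 'v)) set" where
  "Phi_map Xt At p smul h c =
     (\<Union>\<rho>\<in>c. rep_class Xt At p smul h
        (\<lambda>f\<in>carrier (fundamental_group Xt At p). fst (\<rho> f)))"

definition Ad_inv :: "('g, 'm) monoid_scheme \<Rightarrow> 'g \<Rightarrow> 'g \<Rightarrow> 'g" where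
  "Ad_inv G s f = inv\<^bsub>G\<^esub> s \<otimes>\<^bsub>G\<^esub> f \<otimes>\<^bsub>G\<^esub> s"

definition kappa_map ::
  "'b::topological_space set \<Rightarrow> 'b chart set \<Rightarrow> ('b \<Rightarrow> 'a) \<Rightarrow> ('a \<Rightarrow> 'a) \<Rightarrow>
   (complex \<Rightarrow> 'v \<Rightarrow> 'v::ab_group_add) \<Rightarrow> ('v \<Rightarrow> 'v \<Rightarrow> complex) \<Rightarrow> ('v \<Rightarrow> 'v) \<Rightarrow> ('b \<Rightarrow> 'b) \<Rightarrow>
   (('b \<Rightarrow> 'b) \<Rightarrow> ('v \<Rightarrow> 'v)) set \<Rightarrow> (('b \<Rightarrow> 'b) \<Rightarrow> ('v \<Rightarrow> 'v)) set" where
  "kappa_map Xt At p \<sigma> smul h \<alpha> st c =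
     (\<Union>\<rho>\<in>c. rep_class Xt At p smul h
        (\<lambda>f\<in>carrier (fundamental_group Xt At p).
           Ad_real \<alpha> (\<rho> (Ad_inv (real_fundamental_group Xt At p \<sigma>) st f))))"

definition Fix_kappa ::
  "'b::topological_space set \<Rightarrow> 'b chart set \<Rightarrow> ('b \<Rightarrow> 'a) \<Rightarrow> ('a \<Rightarrow> 'a) \<Rightarrow>
   (complex \<Rightarrow> 'v \<Rightarrow> 'v::ab_group_add) \<Rightarrow> ('v \<Rightarrow> 'v \<Rightarrow> complex) \<Rightarrow> ('v \<Rightarrow> 'v) \<Rightarrow> ('b \<Rightarrow> 'b) \<Rightarrow>
   (('b \<Rightarrow> 'b) \<Rightarrow> ('v \<Rightarrow> 'v)) set set" where
  "Fix_kappa Xt At p \<sigma> smul h \<alpha> st =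
     {c \<in> rep_space Xt At p smul h. kappa_map Xt At p \<sigma> smul h \<alpha> st c = c}"

end

theory Submission
  imports Defs "HOL-Complex_Analysis.Cauchy_Integral_Formula"
begin

text \<open>The idea is to compare a representation \<open>\<rho>\<close> of \<open>\<pi>\<^sub>1\<close> with its twist by an element \<open>st\<close> of
  \<open>\<pi>\<^sub>1\<^sup>\<real>\<close> outside \<open>\<pi>\<^sub>1\<close>.

  If \<open>\<rho>\<close> is the restriction of a homomorphism on \<open>\<pi>\<^sub>1\<^sup>\<real>\<close> that sends \<open>st\<close> to \<open>a \<circ> \<alpha>\<close> with \<open>a\<close> unitary,
  then the relation between \<open>st\<close>, \<open>f\<close> and \<open>st\<inverse> f st\<close> is carried to the target, and it says that the
  twist of \<open>\<rho>\<close> is conjugate to \<open>\<rho>\<close> under \<open>a\<close> (\<open>twist_topological_part\<close>). So the class of \<open>\<rho>\<close> is fixed by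
  \<open>\<kappa>\<close>. The argument computes with inverses and products in \<open>\<pi>\<^sub>1\<^sup>\<real>\<close>, and therefore needs this set of
  diffeomorphisms to be a group. For that, compositions of maps that are smooth in charts have to be
  smooth; this rests on the chain rule for \<open>C\<^sup>k\<close> maps (\<open>Ck_on_compose\<close>).

  Conversely, let \<open>\<rho>\<close> be fixed by \<open>\<kappa>\<close>, say with twist equal to \<open>\<rho>\<close> conjugated by the inverse of a
  unitary \<open>a\<close>. An extension has to send \<open>st\<close> to some such \<open>a \<circ> \<alpha>\<close>, and the square of \<open>st\<close>, which lies in
  \<open>\<pi>\<^sub>1\<close>, must then be sent to \<open>a \<circ> \<alpha> \<circ> a \<circ> \<alpha>\<close>. This can fail already in rank one, where
  \<open>a \<circ> \<alpha> \<circ> a \<circ> \<alpha>\<close> is always the identity. The example is the punctured plane with the antipodal map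
  \<open>z \<mapsto> - 1 / cnj z\<close> and the universal cover \<open>exp\<close>. The antipodal map lifts to
  \<open>w \<mapsto> \<i> \<pi> - cnj w\<close>, whose square is the generator \<open>w \<mapsto> w + 2 \<pi> \<i>\<close> of the infinite cyclic group \<open>\<pi>\<^sub>1\<close>.
  The character that sends this generator to \<open>-1\<close> is real and invariant under conjugation by the lift,
  hence fixed by \<open>\<kappa>\<close> (\<open>twist_sign_rep\<close>), but an extendable character sends the generator to
  \<open>1\<close> (\<open>extended_rep_winding\<close>).\<close>


section \<open>Calculus of continuously differentiable maps\<close>

text \<open>The recursive clause of \<^const>\<open>Ck_on\<close> speaks of Frechet derivatives at points of \<open>S\<close>, which
depend on values near these points; openness of \<open>S\<close> keeps the relevant values inside \<open>S\<close>.\<close>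

lemma Ck_on_cong:
  assumes "open S" "Ck_on k f S" "\<And>z. z \<in> S \<Longrightarrow> f z = g z"
  shows "Ck_on k g S"
  using assms(2,3)
proof (induction k arbitrary: f g)
  case 0
  then show ?case using continuous_on_cong by (metis Ck_on.simps(1))
next
  case (Suc k)
  have der: "(g has_derivative frechet_derivative f (at z)) (at z)" if "z \<in> S" for z
  proof -
    have "(f has_derivative frechet_derivative f (at z)) (at z)"
      using Suc.prems(1) that by (simp add: frechet_derivative_works)
    then show ?thesis
      using has_derivative_transform_within_open[OF _ assms(1) that] Suc.prems(2) by blast
  qed
  have "Ck_on k (\<lambda>z. frechet_derivative g (at z) v) S" for v
  proof (rule Suc.IH)
    show "Ck_on k (\<lambda>z. frechet_derivative f (at z) v) S"
      using Suc.prems(1) by simp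
    show "frechet_derivative f (at z) v = frechet_derivative g (at z) v" if "z \<in> S" for z
      using frechet_derivative_at[OF der[OF that]] by simp
  qed
  with der show ?case by (auto simp: differentiable_def)
qed

text \<open>Exhibiting a derivative \<open>f'\<close> replaces computations with \<^const>\<open>frechet_derivative\<close>. All the closure
properties below are proved with this rule, by induction on the order of differentiability.\<close>

lemma Ck_on_SucI:
  assumes "open S" and der: "\<And>z. z \<in> S \<Longrightarrow> (f has_derivative f' z) (at z)"
    and Ck: "\<And>v. Ck_on k (\<lambda>z. f' z v) S"
  shows "Ck_on (Suc k) f S"
proof -
  have "Ck_on k (\<lambda>z. frechet_derivative f (at z) v) S" for v
    by (rule Ck_on_cong[OF assms(1) Ck]) (simp add: frechet_derivative_at[OF der, symmetric])
  with der show ?thesis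
    by (auto simp: differentiable_def)
qed

lemma Ck_on_SucD: "Ck_on (Suc k) f S \<Longrightarrow> Ck_on k f S"
proof (induction k arbitrary: f)
  case 0
  then show ?case
    by (simp add: continuous_at_imp_continuous_on differentiable_imp_continuous_within)
next
  case (Suc k)
  then show ?case by (metis Ck_on.simps(2))
qed

lemma Ck_on_has_derivative:
  "Ck_on (Suc k) f S \<Longrightarrow> z \<in> S \<Longrightarrow> (f has_derivative frechet_derivative f (at z)) (at z)"
  by (simp add: frechet_derivative_works)

lemma Ck_on_subset: "Ck_on k f S \<Longrightarrow> T \<subseteq> S \<Longrightarrow> Ck_on k f T"
  by (induction k arbitrary: f) (auto intro: continuous_on_subset)

lemma Ck_on_local:
  assumes "\<And>z. z \<in> S \<Longrightarrow> \<exists>T. open T \<and> z \<in> T \<and> Ck_on k f T"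
  shows "Ck_on k f S"
  using assms
proof (induction k arbitrary: f)
  case 0
  have "isCont f z" if "z \<in> S" for z
    using 0[OF that] by (auto simp: continuous_on_eq_continuous_at)
  then show ?case by (simp add: continuous_at_imp_continuous_on)
next
  case (Suc k)
  show ?case
    unfolding Ck_on.simps
  proof (intro conjI ballI allI)
    show "f differentiable at z" if "z \<in> S" for z
      using Suc.prems[OF that] by auto
    show "Ck_on k (\<lambda>z. frechet_derivative f (at z) v) S" for v
      by (rule Suc.IH) (use Suc.prems in fastforce)
  qed
qed

lemma Ck_on_const: "open S \<Longrightarrow> Ck_on k (\<lambda>z. c) S"
proof (induction k arbitrary: c)
  case (Suc k)
  show ?case
    by (rule Ck_on_SucI[where f' = "\<lambda>_ _. 0"]) (use Suc in auto)
qed simp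

lemma Ck_on_bounded_linear:
  assumes "bounded_linear L" "open S" "Ck_on k f S"
  shows "Ck_on k (\<lambda>z. L (f z)) S"
  using assms(3)
proof (induction k arbitrary: f)
  case 0
  then show ?case
    using assms(1) by (simp add: bounded_linear.continuous_on)
next
  case (Suc k)
  show ?case
  proof (rule Ck_on_SucI[OF assms(2)])
    show "((\<lambda>z. L (f z)) has_derivative (\<lambda>v. L (frechet_derivative f (at z) v))) (at z)"
      if "z \<in> S" for z
      using bounded_linear.has_derivative[OF assms(1) Ck_on_has_derivative[OF Suc.prems that]] .
    show "Ck_on k (\<lambda>z. L (frechet_derivative f (at z) v)) S" for v
      by (rule Suc.IH) (use Suc.prems in simp)
  qed
qed

lemma Ck_on_add:
  assumes "open S" "Ck_on k f S" "Ck_on k g S"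
  shows "Ck_on k (\<lambda>z. f z + g z) S"
  using assms(2,3)
proof (induction k arbitrary: f g)
  case 0
  then show ?case by (simp add: continuous_on_add)
next
  case (Suc k)
  show ?case
  proof (rule Ck_on_SucI[OF assms(1)])
    show "((\<lambda>z. f z + g z) has_derivative
        (\<lambda>v. frechet_derivative f (at z) v + frechet_derivative g (at z) v)) (at z)"
      if "z \<in> S" for z
      by (intro has_derivative_add Ck_on_has_derivative[OF _ that]) (use Suc.prems in auto)
    show "Ck_on k (\<lambda>z. frechet_derivative f (at z) v + frechet_derivative g (at z) v) S" for v
      by (rule Suc.IH) (use Suc.prems in simp_all)
  qed
qed

lemma Ck_on_sum:
  assumes "open S" "\<And>i. i \<in> I \<Longrightarrow> Ck_on k (f i) S"
  shows "Ck_on k (\<lambda>z. \<Sum>i\<in>I. f i z) S"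
  using assms(2)
  by (induction I rule: infinite_finite_induct) (auto intro: Ck_on_add Ck_on_const assms(1))

lemma Ck_on_scaleR:
  fixes f :: "'a::euclidean_space \<Rightarrow> real"
  assumes "open S" "Ck_on k f S" "Ck_on k g S"
  shows "Ck_on k (\<lambda>z. f z *\<^sub>R g z) S"
  using assms(2,3)
proof (induction k arbitrary: f g)
  case 0
  then show ?case by (simp add: continuous_on_scaleR)
next
  case (Suc k)
  show ?case
  proof (rule Ck_on_SucI[OF assms(1)])
    show "((\<lambda>z. f z *\<^sub>R g z) has_derivative
        (\<lambda>v. f z *\<^sub>R frechet_derivative g (at z) v + frechet_derivative f (at z) v *\<^sub>R g z)) (at z)"
      if "z \<in> S" for z
      by (intro has_derivative_scaleR Ck_on_has_derivative[OF _ that]) (use Suc.prems in auto)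
    show "Ck_on k (\<lambda>z. f z *\<^sub>R frechet_derivative g (at z) v
        + frechet_derivative f (at z) v *\<^sub>R g z) S" for v
      by (intro Ck_on_add assms(1) Suc.IH)
        (use Suc.prems Ck_on_SucD in \<open>auto simp del: Ck_on.simps(1)\<close>)
  qed
qed

text \<open>The chain rule gives \<open>(g \<circ> f)' z v = g' (f z) (f' z v)\<close>, where the direction in which \<open>g\<close> is
differentiated varies with \<open>z\<close>, whereas \<^const>\<open>Ck_on\<close> speaks of fixed directions only. Expanding
\<open>f' z v\<close> in the standard basis turns the derivative into a sum of products of functions of
class \<open>C\<^sup>k\<close>: coordinates of \<open>f'\<close>, and partial derivatives of \<open>g\<close> composed with \<open>f\<close>, to which the
induction hypothesis applies.\<close>

lemma Ck_on_compose:
  fixes f :: "'a::euclidean_space \<Rightarrow> 'b::euclidean_space"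
    and g :: "'b \<Rightarrow> 'c::real_normed_vector"
  assumes S: "open S" and fS: "f ` S \<subseteq> T" and f: "Ck_on k f S" and g: "Ck_on k g T"
  shows "Ck_on k (g \<circ> f) S"
  using f g
proof (induction k arbitrary: g)
  case 0
  then show ?case
    using fS by (auto intro: continuous_on_compose2)
next
  case (Suc k)
  let ?f' = "\<lambda>z. frechet_derivative f (at z)" and ?g' = "\<lambda>w. frechet_derivative g (at w)"
  let ?D = "\<lambda>z v. \<Sum>b\<in>Basis. (?f' z v \<bullet> b) *\<^sub>R ?g' (f z) b"
  show ?case
  proof (rule Ck_on_SucI[OF S])
    fix z assume z: "z \<in> S"
    with fS have "f z \<in> T" by auto
    then have g': "(g has_derivative ?g' (f z)) (at (f z))"
      using Ck_on_has_derivative[OF Suc.prems(2)] by blast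
    have "(g \<circ> f has_derivative ?g' (f z) \<circ> ?f' z) (at z)"
      by (rule diff_chain_at[OF Ck_on_has_derivative[OF Suc.prems(1) z] g'])
    moreover have "?g' (f z) \<circ> ?f' z = ?D z"
    proof
      fix v
      interpret linear "?g' (f z)"
        using g' has_derivative_linear by blast
      have "?g' (f z) (?f' z v) = ?g' (f z) (\<Sum>b\<in>Basis. (?f' z v \<bullet> b) *\<^sub>R b)"
        by (simp add: euclidean_representation)
      then show "(?g' (f z) \<circ> ?f' z) v = ?D z v"
        by (simp add: sum scale)
    qed
    ultimately show "(g \<circ> f has_derivative ?D z) (at z)" by simp
  next
    fix v
    have "Ck_on k ((\<lambda>w. ?g' w b) \<circ> f) S" for b
      by (rule Suc.IH) (use Suc.prems Ck_on_SucD in auto)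
    then show "Ck_on k (\<lambda>z. ?D z v) S"
      using Suc.prems(1)
      by (intro Ck_on_sum Ck_on_scaleR S Ck_on_bounded_linear[OF bounded_linear_inner_left])
        (auto simp: o_def)
  qed
qed

text \<open>The directional derivative of \<open>f\<close> in the direction \<open>v\<close> is \<open>deriv f z * v\<close>, again holomorphic.\<close>

lemma holomorphic_on_imp_Ck_on:
  assumes "open S" "f holomorphic_on S"
  shows "Ck_on k f S"
  using assms(2)
proof (induction k arbitrary: f)
  case 0
  then show ?case by (simp add: holomorphic_on_imp_continuous_on)
next
  case (Suc k)
  show ?case
  proof (rule Ck_on_SucI[OF assms(1)])
    show "(f has_derivative (*) (deriv f z)) (at z)" if "z \<in> S" for z
      using holomorphic_derivI[OF Suc.prems assms(1) that]
      by (simp add: has_field_derivative_def)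
    show "Ck_on k (\<lambda>z. deriv f z * v) S" for v
      using assms(1) Suc.prems by (intro Suc.IH holomorphic_intros holomorphic_deriv)
  qed
qed


section \<open>Smooth maps between Riemann surfaces\<close>

lemma complex_atlas_chart:
  assumes "complex_atlas X A" "(U, \<phi>) \<in> A"
  shows "inj_on \<phi> U" "U \<subseteq> X"
  using assms unfolding complex_atlas_def homeomorphism_def
  by (fastforce intro: inj_on_inverseI openin_imp_subset)+

lemma complex_atlas_open_image:
  assumes "complex_atlas X A" "(U, \<phi>) \<in> A" "openin (top_of_set X) W"
  shows "open (\<phi> ` (U \<inter> W))"
proof -
  obtain \<psi> where U: "openin (top_of_set X) U" "open (\<phi> ` U)" "homeomorphism U (\<phi> ` U) \<phi> \<psi>"
    using assms(1,2) unfolding complex_atlas_def by blast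
  have "openin (top_of_set U) (U \<inter> W)"
    using assms(3) U(1) by (metis openin_Int openin_imp_subset openin_subset_trans inf_le1)
  then have "openin (top_of_set (\<phi> ` U)) (\<phi> ` (U \<inter> W))"
    by (rule homeomorphism_imp_open_map[OF U(3)])
  with U(2) show ?thesis by (metis openin_open_eq)
qed

lemma complex_atlas_open_chart_domain:
  assumes A: "complex_atlas X A" "(U, \<phi>) \<in> A" and B: "complex_atlas Y B" "(W, \<psi>) \<in> B"
    and f: "continuous_on X f" "f ` X \<subseteq> Y"
  shows "open (\<phi> ` (U \<inter> f -` W))"
proof -
  have "openin (top_of_set Y) W"
    using B unfolding complex_atlas_def by blast
  then have "openin (top_of_set X) (X \<inter> f -` W)"
    using f by (metis continuous_openin_preimage image_subset_iff_funcset)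
  moreover have "U \<inter> f -` W = U \<inter> (X \<inter> f -` W)"
    using complex_atlas_chart[OF A] by blast
  ultimately show ?thesis
    using complex_atlas_open_image[OF A] by metis
qed

lemma smooth_mapD:
  assumes "smooth_map X A Y B f"
  shows "continuous_on X f" "f ` X \<subseteq> Y"
    and "(U, \<phi>) \<in> A \<Longrightarrow> (W, \<psi>) \<in> B
      \<Longrightarrow> Ck_on k (\<psi> \<circ> f \<circ> inv_into U \<phi>) (\<phi> ` (U \<inter> f -` W))"
  using assms unfolding smooth_map_def map_in_charts_def by blast+

lemma smooth_mapI:
  assumes "continuous_on X f" "f ` X \<subseteq> Y"
    and "\<And>U \<phi> W \<psi> k. (U, \<phi>) \<in> A \<Longrightarrow> (W, \<psi>) \<in> B
      \<Longrightarrow> Ck_on k (\<psi> \<circ> f \<circ> inv_into U \<phi>) (\<phi> ` (U \<inter> f -` W))"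
  shows "smooth_map X A Y B f"
  using assms unfolding smooth_map_def map_in_charts_def by blast

lemma smooth_map_cong:
  assumes A: "complex_atlas X A" and B: "complex_atlas Y B"
    and f: "smooth_map X A Y B f" and eq: "\<And>y. y \<in> X \<Longrightarrow> f y = g y"
  shows "smooth_map X A Y B g"
proof -
  note f1 = smooth_mapD(1,2)[OF f]
  have "continuous_on X g" "g ` X \<subseteq> Y"
    using f1 eq continuous_on_cong[of X X f g] by auto
  moreover have "Ck_on k (\<psi> \<circ> g \<circ> inv_into U \<phi>) (\<phi> ` (U \<inter> g -` W))"
    if "(U, \<phi>) \<in> A" "(W, \<psi>) \<in> B" for U \<phi> W \<psi> k
  proof -
    note U = complex_atlas_chart[OF A that(1)]
    have dom: "U \<inter> g -` W = U \<inter> f -` W"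
      using U(2) eq by auto
    show ?thesis
      unfolding dom
    proof (rule Ck_on_cong)
      show "open (\<phi> ` (U \<inter> f -` W))"
        by (rule complex_atlas_open_chart_domain[OF A that(1) B that(2) f1])
      show "Ck_on k (\<psi> \<circ> f \<circ> inv_into U \<phi>) (\<phi> ` (U \<inter> f -` W))"
        using that by (rule smooth_mapD(3)[OF f])
      show "(\<psi> \<circ> f \<circ> inv_into U \<phi>) z = (\<psi> \<circ> g \<circ> inv_into U \<phi>) z"
        if "z \<in> \<phi> ` (U \<inter> f -` W)" for z
        using that U eq by auto
    qed
  qed
  ultimately show ?thesis
    by (rule smooth_mapI)
qed

text \<open>An expression of \<open>g \<circ> f\<close> in charts of \<open>X\<close> and \<open>Z\<close> need not factor through one chart of \<open>Y\<close>. Near each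
point it does, which suffices because \<open>C\<^sup>k\<close> is a local property.\<close>

lemma smooth_map_compose:
  assumes A: "complex_atlas X A" and B: "complex_atlas Y B" and C: "complex_atlas Z C"
    and f: "smooth_map X A Y B f" and g: "smooth_map Y B Z C g"
  shows "smooth_map X A Z C (g \<circ> f)"
proof -
  note f1 = smooth_mapD(1,2)[OF f]
  note g1 = smooth_mapD(1,2)[OF g]
  have gf: "continuous_on X (g \<circ> f)" "(g \<circ> f) ` X \<subseteq> Z"
    using f1 g1 by (auto intro: continuous_on_compose2)
  moreover have "Ck_on k (\<psi> \<circ> (g \<circ> f) \<circ> inv_into U \<phi>) (\<phi> ` (U \<inter> (g \<circ> f) -` W))"
    if U: "(U, \<phi>) \<in> A" and W: "(W, \<psi>) \<in> C" for U \<phi> W \<psi> k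
  proof (rule Ck_on_local)
    note inj = complex_atlas_chart[OF A U]
    fix z assume "z \<in> \<phi> ` (U \<inter> (g \<circ> f) -` W)"
    then obtain y where y: "y \<in> U" "g (f y) \<in> W" "z = \<phi> y" by auto
    then have "f y \<in> Y" using inj f1 by auto
    then obtain V \<theta> where V: "(V, \<theta>) \<in> B" "f y \<in> V"
      using B unfolding complex_atlas_def by blast
    note injV = complex_atlas_chart[OF B V(1)]
    let ?S = "\<phi> ` (U \<inter> f -` V)" and ?T = "\<theta> ` (V \<inter> g -` W)"
    let ?R = "?S \<inter> \<phi> ` (U \<inter> (g \<circ> f) -` W)"
    let ?F = "\<theta> \<circ> f \<circ> inv_into U \<phi>" and ?G = "\<psi> \<circ> g \<circ> inv_into V \<theta>"
    have openR: "open ?R"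
      using complex_atlas_open_chart_domain[OF A U B V(1) f1]
        complex_atlas_open_chart_domain[OF A U C W gf] by blast
    have R: "\<exists>q. q \<in> U \<and> f q \<in> V \<and> g (f q) \<in> W \<and> w = \<phi> q" if w: "w \<in> ?R" for w
    proof -
      obtain q r where "q \<in> U" "f q \<in> V" "w = \<phi> q" "r \<in> U" "g (f r) \<in> W" "w = \<phi> r"
        using w by auto
      then show ?thesis using inj_onD[OF inj(1), of q r] by auto
    qed
    have "Ck_on k (?G \<circ> ?F) ?R"
    proof (rule Ck_on_compose[OF openR])
      show "?F ` ?R \<subseteq> ?T"
      proof (rule image_subsetI)
        fix w assume "w \<in> ?R"
        from R[OF this] obtain q where "q \<in> U" "f q \<in> V" "g (f q) \<in> W" "w = \<phi> q" by blast
        then show "?F w \<in> ?T" using inv_into_f_f[OF inj(1)] by simp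
      qed
      show "Ck_on k ?F ?R"
        by (rule Ck_on_subset[OF smooth_mapD(3)[OF f U V(1)] Int_lower1])
      show "Ck_on k ?G ?T"
        by (rule smooth_mapD(3)[OF g V(1) W])
    qed
    then have "Ck_on k (\<psi> \<circ> (g \<circ> f) \<circ> inv_into U \<phi>) ?R"
    proof (rule Ck_on_cong[OF openR])
      fix w assume "w \<in> ?R"
      from R[OF this] obtain q where "q \<in> U" "f q \<in> V" "g (f q) \<in> W" "w = \<phi> q" by blast
      then show "(?G \<circ> ?F) w = (\<psi> \<circ> (g \<circ> f) \<circ> inv_into U \<phi>) w"
        using inv_into_f_f[OF inj(1)] inv_into_f_f[OF injV(1)] by simp
    qed
    moreover have "z \<in> ?R" using y V by auto
    ultimately show "\<exists>T. open T \<and> z \<in> T \<and> Ck_on k (\<psi> \<circ> (g \<circ> f) \<circ> inv_into U \<phi>) T"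
      using openR by (intro exI[of _ ?R] conjI)
  qed
  ultimately show ?thesis
    by (rule smooth_mapI)
qed

text \<open>The expressions of the identity in charts are the transition maps.\<close>

lemma smooth_map_id:
  assumes A: "complex_atlas X A"
  shows "smooth_map X A X A id"
proof -
  have "Ck_on k (\<psi> \<circ> id \<circ> inv_into U \<phi>) (\<phi> ` (U \<inter> id -` W))"
    if "(U, \<phi>) \<in> A" "(W, \<psi>) \<in> A" for U \<phi> W \<psi> k
  proof (rule holomorphic_on_imp_Ck_on)
    show "open (\<phi> ` (U \<inter> id -` W))"
      by (rule complex_atlas_open_chart_domain[OF A that(1) A that(2)]) auto
    show "\<psi> \<circ> id \<circ> inv_into U \<phi> holomorphic_on \<phi> ` (U \<inter> id -` W)"
      using A that unfolding complex_atlas_def by auto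
  qed
  then show ?thesis
    by (intro smooth_mapI) auto
qed


section \<open>Opposite groups, semidirect products and conjugation\<close>

lemma opposite_simps [simp]:
  "carrier (opposite G) = carrier G"
  "\<one>\<^bsub>opposite G\<^esub> = \<one>\<^bsub>G\<^esub>"
  "f \<otimes>\<^bsub>opposite G\<^esub> g = g \<otimes>\<^bsub>G\<^esub> f"
  by (simp_all add: opposite_def)

lemma group_opposite:
  assumes "group G"
  shows "group (opposite G)"
proof -
  interpret group G by fact
  show ?thesis
    by (rule groupI) (auto simp: m_assoc intro: r_inv_ex)
qed

lemma inv_opposite:
  assumes "group G" "x \<in> carrier G"
  shows "inv\<^bsub>opposite G\<^esub> x = inv\<^bsub>G\<^esub> x"
proof -
  interpret group G by fact
  show ?thesis
    using assms by (intro group.inv_equality[OF group_opposite]) auto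
qed

lemma subgroup_opposite:
  assumes "group G" "subgroup H G"
  shows "subgroup H (opposite G)"
proof -
  interpret group "opposite G" using assms(1) by (rule group_opposite)
  interpret H: subgroup H G by fact
  show ?thesis
  proof (rule subgroupI)
    show "H \<noteq> {}" using H.one_closed by blast
  qed (use H.subset H.m_closed H.m_inv_closed
        in \<open>auto simp: inv_opposite[OF assms(1)] H.mem_carrier\<close>)
qed

lemma group_semidirect_product:
  assumes N: "group N" and H: "group H"
    and hom: "\<And>a. a \<in> carrier H \<Longrightarrow> \<theta> a \<in> hom N N"
    and one: "\<And>v. v \<in> carrier N \<Longrightarrow> \<theta> \<one>\<^bsub>H\<^esub> v = v"
    and act: "\<And>a b v. \<lbrakk>a \<in> carrier H; b \<in> carrier H; v \<in> carrier N\<rbrakk>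
      \<Longrightarrow> \<theta> (a \<otimes>\<^bsub>H\<^esub> b) v = \<theta> a (\<theta> b v)"
  shows "group (semidirect_product N H \<theta>)"
proof -
  interpret N: group N by fact
  interpret H: group H by fact
  have cl: "\<theta> a v \<in> carrier N" if "a \<in> carrier H" "v \<in> carrier N" for a v
    using hom_in_carrier[OF hom[OF that(1)] that(2)] .
  have mult: "\<theta> a (v \<otimes>\<^bsub>N\<^esub> w) = \<theta> a v \<otimes>\<^bsub>N\<^esub> \<theta> a w"
    if "a \<in> carrier H" "v \<in> carrier N" "w \<in> carrier N" for a v w
    using hom_mult[OF hom[OF that(1)] that(2,3)] .
  have theta_one: "\<theta> a \<one>\<^bsub>N\<^esub> = \<one>\<^bsub>N\<^esub>" if "a \<in> carrier H" for a
    using hom_one[OF hom[OF that] N N] .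
  show ?thesis
  proof (rule groupI, goal_cases)
    case (5 x)
    then obtain u a where x: "x = (u, a)" and ua: "u \<in> carrier N" "a \<in> carrier H"
      by (auto simp: semidirect_product_def)
    let ?y = "(\<theta> (inv\<^bsub>H\<^esub> a) (inv\<^bsub>N\<^esub> u), inv\<^bsub>H\<^esub> a)"
    have "\<theta> (inv\<^bsub>H\<^esub> a) (inv\<^bsub>N\<^esub> u) \<otimes>\<^bsub>N\<^esub> \<theta> (inv\<^bsub>H\<^esub> a) u = \<one>\<^bsub>N\<^esub>"
      using ua mult[of "inv\<^bsub>H\<^esub> a" "inv\<^bsub>N\<^esub> u" u] by (simp add: theta_one)
    then have "?y \<otimes>\<^bsub>semidirect_product N H \<theta>\<^esub> x = \<one>\<^bsub>semidirect_product N H \<theta>\<^esub>"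
      using ua by (simp add: semidirect_product_def x)
    moreover have "?y \<in> carrier (semidirect_product N H \<theta>)"
      using ua by (simp add: semidirect_product_def cl)
    ultimately show ?case by blast
  qed (auto simp: semidirect_product_def cl mult act one N.m_assoc H.m_assoc)
qed

lemma conj_hom_apply:
  "g \<in> carrier K \<Longrightarrow> conj_hom K U u \<rho> g = u \<otimes>\<^bsub>U\<^esub> \<rho> g \<otimes>\<^bsub>U\<^esub> inv\<^bsub>U\<^esub> u"
  by (simp add: conj_hom_def)

lemma conj_hom_conj_hom:
  assumes "group U" "a \<in> carrier U" "b \<in> carrier U" "\<And>g. g \<in> carrier K \<Longrightarrow> \<rho> g \<in> carrier U"
  shows "conj_hom K U a (conj_hom K U b \<rho>) = conj_hom K U (a \<otimes>\<^bsub>U\<^esub> b) \<rho>"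
proof -
  interpret group U by fact
  show ?thesis
    using assms(2-) by (auto simp: conj_hom_def m_assoc inv_mult_group intro!: restrict_ext)
qed

text \<open>The conjugate of \<open>\<rho>\<close> by \<open>a\<close> is the conjugate by \<open>a b\<inverse>\<close> of its conjugate by \<open>b\<close>. On maps that are not
extensional, the unit of \<open>U\<close> changes values outside the carrier of \<open>K\<close>, so that \<^const>\<open>conj_hom\<close> is not
a group action there; the composition law alone gives the claim.\<close>

lemma orbit_conj_hom:
  assumes U: "group U" "b \<in> carrier U" and \<rho>: "\<And>g. g \<in> carrier K \<Longrightarrow> \<rho> g \<in> carrier U"
  shows "orbit U (conj_hom K U) (conj_hom K U b \<rho>) = orbit U (conj_hom K U) \<rho>"
proof -
  interpret group U by fact
  have "conj_hom K U a \<rho> = conj_hom K U (a \<otimes>\<^bsub>U\<^esub> inv\<^bsub>U\<^esub> b) (conj_hom K U b \<rho>)"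
    if "a \<in> carrier U" for a
    using that assms by (simp add: conj_hom_conj_hom m_assoc)
  moreover have "conj_hom K U a (conj_hom K U b \<rho>) = conj_hom K U (a \<otimes>\<^bsub>U\<^esub> b) \<rho>"
    if "a \<in> carrier U" for a
    using that assms by (simp add: conj_hom_conj_hom)
  ultimately show ?thesis
    unfolding orbit_def using U(2) by (blast intro: m_closed inv_closed)
qed

lemma HomD:
  assumes "\<rho> \<in> Hom K L"
  shows "g \<in> carrier K \<Longrightarrow> \<rho> g \<in> carrier L"
    and "g \<in> carrier K \<Longrightarrow> g' \<in> carrier K \<Longrightarrow> \<rho> (g \<otimes>\<^bsub>K\<^esub> g') = \<rho> g \<otimes>\<^bsub>L\<^esub> \<rho> g'"
  using assms by (auto simp: Hom_def hom_def)


lemma self_diffeosD: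
  assumes "f \<in> self_diffeos Xt At"
  shows "f \<in> Bij Xt" "smooth_map Xt At Xt At f" "smooth_map Xt At Xt At (inv_into Xt f)"
  using assms by (auto simp: self_diffeos_def)

lemma inv_into_compose_Bij:
  assumes f: "f \<in> Bij S" and g: "g \<in> Bij S" and y: "y \<in> S"
  shows "inv_into S (compose S f g) y = inv_into S g (inv_into S f y)"
proof (rule inv_into_f_eq)
  show "inj_on (compose S f g) S"
    using compose_Bij[OF f g] by (simp add: Bij_def bij_betw_def)
  have "f ` S = S" "g ` S = S"
    using f g by (auto simp: Bij_def bij_betw_def)
  then show "inv_into S g (inv_into S f y) \<in> S"
    "compose S f g (inv_into S g (inv_into S f y)) = y"
    using y by (simp_all add: compose_def inv_into_into f_inv_into_f)
qed

text \<open>Elements of \<^const>\<open>self_diffeos\<close> are extensional, so group inverses are restrictions of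
\<^const>\<open>inv_into\<close>. Smoothness is transferred along equality on \<open>Xt\<close> by \<open>smooth_map_cong\<close>.\<close>

lemma subgroup_self_diffeos:
  assumes At: "complex_atlas Xt At"
  shows "subgroup (self_diffeos Xt At) (BijGroup Xt)"
proof (rule group.subgroupI[OF group_BijGroup], goal_cases)
  case 1
  show ?case by (auto simp: BijGroup_def self_diffeos_def)
next
  case 2
  have "inv_into Xt (\<lambda>x\<in>Xt. x) y = y" if "y \<in> Xt" for y
    using that by (intro inv_into_f_eq) (auto simp: inj_on_def)
  then have "(\<lambda>x\<in>Xt. x) \<in> self_diffeos Xt At"
    by (auto simp: self_diffeos_def id_Bij intro!: smooth_map_cong[OF At At smooth_map_id[OF At]])
  then show ?case by blast
next
  case (3 f)
  note f = self_diffeosD[OF 3]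
  let ?g = "restrict (inv_into Xt f) Xt"
  have g: "?g \<in> Bij Xt" by (rule restrict_inv_into_Bij[OF f(1)])
  have "f y = inv_into Xt ?g y" if "y \<in> Xt" for y
  proof (rule inv_into_f_eq[symmetric])
    show "inj_on ?g Xt" using g by (simp add: Bij_def bij_betw_def)
    show "f y \<in> Xt" using Bij_imp_funcset[OF f(1)] that by auto
    then show "?g (f y) = y" using that f(1) by (simp add: Bij_def bij_betw_def)
  qed
  then have "smooth_map Xt At Xt At (inv_into Xt ?g)"
    by (rule smooth_map_cong[OF At At f(2)])
  moreover have "smooth_map Xt At Xt At ?g"
    by (rule smooth_map_cong[OF At At f(3)]) simp
  ultimately show ?case
    using g f(1) by (simp add: self_diffeos_def inv_BijGroup)
next
  case (4 f g)
  note f = self_diffeosD[OF 4(1)] and g = self_diffeosD[OF 4(2)]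
  have "smooth_map Xt At Xt At (compose Xt f g)"
    by (rule smooth_map_cong[OF At At smooth_map_compose[OF At At At g(2) f(2)]])
      (simp add: compose_def)
  moreover have "smooth_map Xt At Xt At (inv_into Xt (compose Xt f g))"
    by (rule smooth_map_cong[OF At At smooth_map_compose[OF At At At f(3) g(3)]])
      (simp add: inv_into_compose_Bij[OF f(1) g(1)])
  ultimately show ?case
    using f(1) g(1) by (simp add: self_diffeos_def BijGroup_def compose_Bij)
qed


section \<open>Real fundamental groups of Klein surfaces\<close>

locale klein_cover =
  fixes X :: "'a::topological_space set" and A and \<sigma> and x
    and Xt :: "'b::topological_space set" and At and xt and p
  assumes klein: "connected_klein_surface X A \<sigma>"
    and cover: "universal_cover Xt At xt p X A x"
begin

abbreviation "G \<equiv> real_fundamental_group Xt At p \<sigma>"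
abbreviation "N \<equiv> fundamental_group Xt At p"

lemma p_in: "y \<in> Xt \<Longrightarrow> p y \<in> X"
  using cover by (auto simp: universal_cover_def covering_space_def)

lemma sigma_sigma: "y \<in> X \<Longrightarrow> \<sigma> (\<sigma> y) = y"
  using klein by (simp add: connected_klein_surface_def)

lemma atlas: "complex_atlas Xt At"
  using cover by (simp add: universal_cover_def riemann_surface_def)

lemma carrier_G: "carrier G = {f \<in> self_diffeos Xt At. \<exists>s\<in>{id, \<sigma>}. \<forall>y\<in>Xt. p (f y) = s (p y)}"
  by (simp add: real_fundamental_group_def)

lemma carrier_N: "carrier N = {f \<in> self_diffeos Xt At. \<forall>y\<in>Xt. p (f y) = p y}"
  by (simp add: fundamental_group_def)

lemma carrier_N_subset: "carrier N \<subseteq> carrier G"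
  unfolding carrier_G carrier_N by fastforce

lemma G_Bij: "f \<in> carrier G \<Longrightarrow> f \<in> Bij Xt"
  unfolding carrier_G self_diffeos_def by blast

lemma G_in: "f \<in> carrier G \<Longrightarrow> y \<in> Xt \<Longrightarrow> f y \<in> Xt"
  using Bij_imp_funcset[OF G_Bij] by auto

lemma mult_G: "f \<in> carrier G \<Longrightarrow> g \<in> carrier G \<Longrightarrow> f \<otimes>\<^bsub>G\<^esub> g = compose Xt g f"
  using G_Bij[of f] G_Bij[of g]
  by (simp add: real_fundamental_group_def BijGroup_def del: bex_simps insert_iff)

lemma mult_N: "f \<otimes>\<^bsub>N\<^esub> g = f \<otimes>\<^bsub>G\<^esub> g"
  by (simp add: real_fundamental_group_def fundamental_group_def)

text \<open>One proof for both fundamental groups: \<open>S = {id, \<sigma>}\<close> gives \<open>G\<close>, and \<open>S = {id}\<close> gives \<open>N\<close>. That \<open>\<sigma>\<close> is an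
involution of \<open>X\<close> makes \<open>S\<close> closed, on \<open>X\<close>, under composition and inverses.\<close>

lemma subgroup_equivariant:
  assumes S: "S \<subseteq> {id, \<sigma>}" "id \<in> S"
  shows "subgroup {f \<in> self_diffeos Xt At. \<exists>s\<in>S. \<forall>y\<in>Xt. p (f y) = s (p y)}
    (opposite (BijGroup Xt))" (is "subgroup ?H _")
proof (rule subgroup_opposite[OF group_BijGroup])
  interpret D: subgroup "self_diffeos Xt At" "BijGroup Xt"
    by (rule subgroup_self_diffeos[OF atlas])
  show "subgroup ?H (BijGroup Xt)"
  proof (rule group.subgroupI[OF group_BijGroup], goal_cases)
    case 1
    show ?case using D.subset by blast
  next
    case 2
    have "(\<lambda>y\<in>Xt. y) \<in> self_diffeos Xt At"
      using D.one_closed by (simp add: BijGroup_def)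
    moreover have "\<forall>y\<in>Xt. p ((\<lambda>y\<in>Xt. y) y) = id (p y)" by simp
    ultimately have "(\<lambda>y\<in>Xt. y) \<in> ?H" using S(2) by blast
    then show ?case by blast
  next
    case (3 f)
    then obtain s where f: "f \<in> self_diffeos Xt At" and s: "s \<in> S"
      and pf: "\<And>y. y \<in> Xt \<Longrightarrow> p (f y) = s (p y)" by blast
    have "s = id \<or> s = \<sigma>" using s S(1) by blast
    then have ss: "s (s q) = q" if "q \<in> X" for q
      using sigma_sigma[OF that] by auto
    have "p (inv_into Xt f y) = s (p y)" if y: "y \<in> Xt" for y
    proof -
      have "inv_into Xt f y \<in> Xt" "f (inv_into Xt f y) = y"
        using y f by (auto simp: self_diffeos_def Bij_inv_into_mem Bij_def bij_betw_def
            f_inv_into_f inv_into_into)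
      then show ?thesis using pf ss p_in by metis
    qed
    with 3 f s D.m_inv_closed[OF f] show ?case
      by (auto simp: inv_BijGroup self_diffeosD)
  next
    case (4 f g)
    then obtain s t where f: "f \<in> self_diffeos Xt At" and s: "s \<in> S"
      and pf: "\<And>y. y \<in> Xt \<Longrightarrow> p (f y) = s (p y)"
      and g: "g \<in> self_diffeos Xt At" and t: "t \<in> S"
      and pg: "\<And>y. y \<in> Xt \<Longrightarrow> p (g y) = t (p y)" by blast
    have "g y \<in> Xt" if "y \<in> Xt" for y
      using that g Bij_imp_funcset[of g Xt] by (auto simp: self_diffeos_def)
    then have "p (f (g y)) = s (t (p y))" if "y \<in> Xt" for y
      using that pf pg by auto
    moreover have "\<exists>r\<in>S. \<forall>q\<in>X. s (t q) = r q"
    proof -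
      have "s = id \<or> t = id \<or> (s = \<sigma> \<and> t = \<sigma>)" using s t S(1) by blast
      then show ?thesis
      proof (elim disjE conjE)
        assume "s = id"
        with t show ?thesis by (intro bexI[of _ t]) auto
      next
        assume "t = id"
        with s show ?thesis by (intro bexI[of _ s]) auto
      next
        assume "s = \<sigma>" "t = \<sigma>"
        with S(2) show ?thesis by (intro bexI[of _ id]) (auto simp: sigma_sigma)
      qed
    qed
    ultimately have "\<exists>r\<in>S. \<forall>y\<in>Xt. p (f (g y)) = r (p y)"
      using p_in by metis
    with D.m_closed[OF f g] f g show ?case
      by (simp add: BijGroup_def self_diffeosD compose_def)
  qed
qed

lemma group_G: "group G"
  unfolding real_fundamental_group_def
  by (rule subgroup.subgroup_is_group[OF subgroup_equivariant group_opposite[OF group_BijGroup]])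
    auto

lemma group_N: "group N"
proof -
  have "carrier N = {f \<in> self_diffeos Xt At. \<exists>s\<in>{id}. \<forall>y\<in>Xt. p (f y) = s (p y)}"
    by (simp add: carrier_N)
  moreover have "group ((opposite (BijGroup Xt))
    \<lparr>carrier := {f \<in> self_diffeos Xt At. \<exists>s\<in>{id}. \<forall>y\<in>Xt. p (f y) = s (p y)}\<rparr>)"
    by (rule subgroup.subgroup_is_group[OF subgroup_equivariant group_opposite[OF group_BijGroup]])
      auto
  ultimately show ?thesis
    unfolding fundamental_group_def by simp
qed

lemma p_odd: "f \<in> carrier G - carrier N \<Longrightarrow> y \<in> Xt \<Longrightarrow> p (f y) = \<sigma> (p y)"
  unfolding carrier_G carrier_N by auto

lemma deck_aug_N: "f \<in> carrier N \<Longrightarrow> deck_aug Xt p f = 0"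
  by (auto simp: deck_aug_def carrier_N)

lemma deck_aug_odd: "f \<in> carrier G - carrier N \<Longrightarrow> deck_aug Xt p f = 1"
  unfolding deck_aug_def carrier_N carrier_G by auto

text \<open>The element \<open>g = st\<inverse> f st\<close> satisfies \<open>st g = f st\<close> in \<open>G\<close>, that is \<open>g \<circ> st = st \<circ> f\<close> as maps. Both \<open>st\<close>
on the left and \<open>st\<close> on the right cover \<open>\<sigma>\<close>, and \<open>f\<close> covers the identity; hence so does \<open>g\<close>.\<close>

lemma Ad_inv_N:
  assumes st: "st \<in> carrier G - carrier N" and f: "f \<in> carrier N"
  shows "Ad_inv G st f \<in> carrier N"
proof -
  interpret G: group G by (rule group_G)
  have st': "st \<in> carrier G" and f': "f \<in> carrier G"
    using st f carrier_N_subset by auto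
  let ?g = "Ad_inv G st f"
  have g: "?g \<in> carrier G"
    using st' f' by (simp add: Ad_inv_def)
  have "st \<otimes>\<^bsub>G\<^esub> ?g = f \<otimes>\<^bsub>G\<^esub> st"
    using st' f' by (simp add: Ad_inv_def G.m_assoc[symmetric])
  then have eq: "compose Xt ?g st = compose Xt st f"
    using st' f' g by (simp add: mult_G)
  have "p (?g y) = p y" if "y \<in> Xt" for y
  proof -
    obtain w where w: "w \<in> Xt" "y = st w"
      using \<open>y \<in> Xt\<close> G_Bij[OF st'] by (auto simp: Bij_def bij_betw_def)
    have "p (?g y) = p (st (f w))"
      using eq w by (metis compose_eq)
    also have "\<dots> = \<sigma> (p (f w))"
      using p_odd[OF st] G_in[OF f' w(1)] by simp
    also have "\<dots> = p y"
      using f w p_odd[OF st w(1)] by (simp add: carrier_N)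
    finally show ?thesis .
  qed
  moreover have "?g \<in> self_diffeos Xt At" using g unfolding carrier_G by blast
  ultimately show ?thesis unfolding carrier_N by blast
qed

lemma Ad_inv_mult:
  assumes st: "st \<in> carrier G" and f: "f \<in> carrier G" "g \<in> carrier G"
  shows "Ad_inv G st (f \<otimes>\<^bsub>G\<^esub> g) = Ad_inv G st f \<otimes>\<^bsub>G\<^esub> Ad_inv G st g"
proof -
  interpret G: group G by (rule group_G)
  have "st \<otimes>\<^bsub>G\<^esub> (inv\<^bsub>G\<^esub> st \<otimes>\<^bsub>G\<^esub> k) = k" if "k \<in> carrier G" for k
    using G.m_assoc[OF st G.inv_closed[OF st] that] G.r_inv[OF st] G.l_one[OF that] by metis
  then show ?thesis using assms by (simp add: Ad_inv_def G.m_assoc)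
qed

end


section \<open>Unitary groups and their real extensions\<close>

locale hermitian_real_space =
  fixes smul :: "complex \<Rightarrow> 'v \<Rightarrow> 'v::ab_group_add" and h and \<alpha>
  assumes herm: "hermitian_space smul h"
    and real: "compatible_real_structure smul h \<alpha>"
begin

abbreviation "U \<equiv> unitary_group smul h"
abbreviation "H \<equiv> unitary_semidirect smul h \<alpha>"

lemma vector_space_smul: "vector_space smul"
  using herm by (auto simp: hermitian_space_def finite_dimensional_vector_space_def)

lemma alpha_alpha [simp]: "\<alpha> (\<alpha> v) = v"
  using real by (simp add: compatible_real_structure_def)

lemma Ad_real_eq: "Ad_real \<alpha> u = \<alpha> \<circ> u \<circ> \<alpha>"
proof -
  have "inv_into UNIV \<alpha> = \<alpha>"
    by (rule inv_equality; simp)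
  then show ?thesis by (simp add: Ad_real_def)
qed

lemma U_simps [simp]: "u \<otimes>\<^bsub>U\<^esub> v = u \<circ> v" "\<one>\<^bsub>U\<^esub> = id"
  by (simp_all add: unitary_group_def)

lemma U_iff: "u \<in> carrier U \<longleftrightarrow>
   Vector_Spaces.linear smul smul u \<and> bij u \<and> (\<forall>v w. h (u v) (u w) = h v w)"
  by (simp add: unitary_group_def)

lemma group_U: "group U"
proof (rule groupI, goal_cases)
  case (1 u v)
  then show ?case
    by (auto simp: U_iff bij_comp intro: Vector_Spaces.linear_compose)
next
  case 2
  show ?case
    using vector_space.linear_id[OF vector_space_smul] by (simp add: U_iff)
next
  case (5 u)
  then have lin: "Vector_Spaces.linear smul smul u" and u: "bij u"
    and iso: "h (u v) (u w) = h v w" for v w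
    by (auto simp: U_iff)
  interpret u: Vector_Spaces.linear smul smul u by fact
  have ui: "u (inv_into UNIV u v) = v" "inv_into UNIV u (u v) = v" for v
    using u by (simp_all add: bij_def surj_f_inv_f)
  have "Vector_Spaces.linear smul smul (inv_into UNIV u)"
  proof (unfold_locales)
    show "inv_into UNIV u (v + w) = inv_into UNIV u v + inv_into UNIV u w" for v w
      using u.add[of "inv_into UNIV u v" "inv_into UNIV u w"] ui by metis
    show "inv_into UNIV u (smul c v) = smul c (inv_into UNIV u v)" for c v
      using u.scale[of c "inv_into UNIV u v"] ui by metis
  qed
  moreover have "h (inv_into UNIV u v) (inv_into UNIV u w) = h v w" for v w
    using iso[of "inv_into UNIV u v" "inv_into UNIV u w"] by (simp add: ui)
  ultimately have "inv_into UNIV u \<in> carrier U"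
    using u by (simp add: U_iff bij_imp_bij_inv)
  moreover have "inv_into UNIV u \<circ> u = id" using ui by auto
  ultimately show ?case by auto
qed auto

lemma Ad_real_hom: "Ad_real \<alpha> \<in> hom U U"
proof (rule homI)
  show "Ad_real \<alpha> u \<in> carrier U" if u: "u \<in> carrier U" for u
  proof -
    have lin: "Vector_Spaces.linear smul smul u" and bij: "bij u"
      and iso: "h (u v) (u w) = h v w" for v w
      using u by (auto simp: U_iff)
    interpret u: Vector_Spaces.linear smul smul u by fact
    have "bij \<alpha>" by (rule o_bij[of \<alpha>]) auto
    then have "bij (\<alpha> \<circ> u \<circ> \<alpha>)" using bij by (simp add: bij_comp)
    moreover have "Vector_Spaces.linear smul smul (\<alpha> \<circ> u \<circ> \<alpha>)"
      using real by unfold_locales (auto simp: compatible_real_structure_def u.add u.scale)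
    moreover have "h (\<alpha> (u (\<alpha> v))) (\<alpha> (u (\<alpha> w))) = h v w" for v w
      using real iso by (simp add: compatible_real_structure_def)
    ultimately show ?thesis by (simp add: U_iff Ad_real_eq)
  qed
qed (auto simp: Ad_real_eq)

lemma Ad_real_Ad_real [simp]: "Ad_real \<alpha> (Ad_real \<alpha> u) = u"
  by (auto simp: Ad_real_eq)

lemma Z2: "a \<in> carrier (integer_mod_group 2) \<longleftrightarrow> a = 0 \<or> a = 1"
  by (auto simp: carrier_integer_mod_group)

lemma H_simps:
  "(u, a) \<in> carrier H \<longleftrightarrow> u \<in> carrier U \<and> (a = 0 \<or> a = 1)"
  "\<one>\<^bsub>H\<^esub> = (id, 0)"
  "(u, a) \<otimes>\<^bsub>H\<^esub> (v, b) = (u \<circ> (if a = 0 then v else Ad_real \<alpha> v), (a + b) mod 2)"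
  by (simp_all add: unitary_semidirect_def semidirect_product_def Z2)

lemma group_H: "group H"
  unfolding unitary_semidirect_def
proof (rule group_semidirect_product[OF group_U group_integer_mod_group], goal_cases)
  case (1 a)
  then show ?case using Ad_real_hom by (simp add: hom_def)
qed (auto simp: Z2)

lemma H_inv: "u \<in> carrier U \<Longrightarrow> inv\<^bsub>H\<^esub> (u, 0) = (inv\<^bsub>U\<^esub> u, 0)"
  using group.inv_closed[OF group_U, of u] group.l_inv[OF group_U, of u]
  by (intro group.inv_equality[OF group_H]) (auto simp: H_simps)

end


section \<open>Restricted representations are fixed by the twist\<close>

locale klein_cover_rep = klein_cover X A \<sigma> x Xt At xt p + hermitian_real_space smul h \<alpha>
  for X :: "'a::topological_space set" and A \<sigma> x
    and Xt :: "'b::topological_space set" and At xt p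
    and smul :: "complex \<Rightarrow> 'v \<Rightarrow> 'v::ab_group_add" and h \<alpha>
begin

abbreviation "cls \<equiv> rep_class Xt At p smul h"
abbreviation "augHom \<equiv> Hom_aug G (deck_aug Xt p) H snd"
abbreviation "topological_part \<rho> \<equiv> (\<lambda>f\<in>carrier N. fst (\<rho> f))"
text \<open>The map \<open>\<kappa>\<close> on the level of representations.\<close>

abbreviation "twist st \<rho> \<equiv> (\<lambda>f\<in>carrier N. Ad_real \<alpha> (\<rho> (Ad_inv G st f)))"

lemma Hom_aug_N:
  assumes "\<rho> \<in> augHom" "f \<in> carrier N"
  shows "fst (\<rho> f) \<in> carrier U" "\<rho> f = (fst (\<rho> f), 0)"
proof -
  have "f \<in> carrier G" using assms(2) carrier_N_subset by auto
  then have "\<rho> f \<in> carrier H" "snd (\<rho> f) = 0"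
    using assms HomD(1)[of \<rho> G H f] by (auto simp: Hom_aug_def deck_aug_N)
  then show "fst (\<rho> f) \<in> carrier U" "\<rho> f = (fst (\<rho> f), 0)"
    by (cases "\<rho> f"; simp add: H_simps)+
qed

lemma Hom_aug_odd:
  assumes \<rho>: "\<rho> \<in> augHom" and st: "st \<in> carrier G - carrier N"
  obtains a where "a \<in> carrier U" "\<rho> st = (a, 1)"
proof -
  have "st \<in> carrier G" using st by simp
  then have "\<rho> st \<in> carrier H" "snd (\<rho> st) = 1"
    using \<rho> HomD(1)[of \<rho> G H st] deck_aug_odd[OF st] by (auto simp: Hom_aug_def)
  then show ?thesis using that by (cases "\<rho> st") (auto simp: H_simps)
qed

lemma topological_part_Hom:
  assumes \<rho>: "\<rho> \<in> augHom"
  shows "topological_part \<rho> \<in> Hom N U"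
proof -
  interpret N: group N by (rule group_N)
  have \<rho>': "\<rho> \<in> Hom G H" using \<rho> by (simp add: Hom_aug_def)
  have "fst (\<rho> (f \<otimes>\<^bsub>N\<^esub> g)) = fst (\<rho> f) \<otimes>\<^bsub>U\<^esub> fst (\<rho> g)"
    if fg: "f \<in> carrier N" "g \<in> carrier N" for f g
  proof -
    have "\<rho> (f \<otimes>\<^bsub>N\<^esub> g) = \<rho> f \<otimes>\<^bsub>H\<^esub> \<rho> g"
      using HomD(2)[OF \<rho>'] fg carrier_N_subset by (auto simp: mult_N)
    also have "\<dots> = (fst (\<rho> f) \<circ> fst (\<rho> g), 0)"
      by (subst Hom_aug_N(2)[OF \<rho> fg(1)], subst Hom_aug_N(2)[OF \<rho> fg(2)])
        (simp add: H_simps)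
    finally show ?thesis by simp
  qed
  then show ?thesis
    using Hom_aug_N(1)[OF \<rho>] by (auto simp: Hom_def hom_def)
qed

lemma topological_part_conj:
  assumes \<rho>: "\<rho> \<in> augHom" and u: "u \<in> carrier U"
  shows "topological_part (conj_hom G H (u, 0) \<rho>) = conj_hom N U u (topological_part \<rho>)"
proof -
  have "fst (conj_hom G H (u, 0) \<rho> f) = u \<circ> fst (\<rho> f) \<circ> inv\<^bsub>U\<^esub> u" if f: "f \<in> carrier N" for f
  proof -
    have "conj_hom G H (u, 0) \<rho> f = (u, 0) \<otimes>\<^bsub>H\<^esub> (fst (\<rho> f), 0) \<otimes>\<^bsub>H\<^esub> inv\<^bsub>H\<^esub> (u, 0)"
      using f carrier_N_subset Hom_aug_N(2)[OF \<rho> f] by (auto simp: conj_hom_apply)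
    then show ?thesis by (simp add: H_simps H_inv u)
  qed
  then show ?thesis by (auto simp: conj_hom_def)
qed

lemma cls_conj:
  assumes "\<rho> \<in> Hom N U" "u \<in> carrier U"
  shows "cls (conj_hom N U u \<rho>) = cls \<rho>"
  unfolding rep_class_def
  by (rule orbit_conj_hom[OF group_U assms(2) HomD(1)[OF assms(1)]])

text \<open>The union in \<^const>\<open>Phi_map\<close> runs over representatives whose restrictions are all conjugate, so it
is the class of any one restriction.\<close>

lemma Phi_map_orbit:
  assumes \<rho>: "\<rho> \<in> augHom"
  shows "Phi_map Xt At p smul h (orbit U (\<lambda>u. conj_hom G H (u, 0)) \<rho>)
    = cls (topological_part \<rho>)"
proof -
  have "\<one>\<^bsub>U\<^esub> \<in> carrier U" using group.is_monoid[OF group_U] by (rule monoid.one_closed)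
  then have "orbit U (\<lambda>u. conj_hom G H (u, 0)) \<rho> \<noteq> {}" by (auto simp: orbit_def)
  moreover have "cls (topological_part \<rho>') = cls (topological_part \<rho>)"
    if "\<rho>' \<in> orbit U (\<lambda>u. conj_hom G H (u, 0)) \<rho>" for \<rho>'
    using that by (auto simp: orbit_def topological_part_conj[OF \<rho>]
        cls_conj[OF topological_part_Hom[OF \<rho>]])
  ultimately show ?thesis unfolding Phi_map_def by simp
qed

lemma twist_Hom:
  assumes st: "st \<in> carrier G - carrier N" and \<rho>: "\<rho> \<in> Hom N U"
  shows "twist st \<rho> \<in> Hom N U"
proof -
  interpret N: group N by (rule group_N)
  have "Ad_inv G st (f \<otimes>\<^bsub>N\<^esub> g) = Ad_inv G st f \<otimes>\<^bsub>N\<^esub> Ad_inv G st g"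
    if "f \<in> carrier N" "g \<in> carrier N" for f g
    using st that carrier_N_subset by (auto simp: mult_N intro!: Ad_inv_mult)
  then show ?thesis
    using HomD[OF \<rho>] Ad_inv_N[OF st] Ad_real_hom unfolding Hom_def hom_def
    by (auto simp del: U_simps)
qed

text \<open>Since \<^term>\<open>Ad_real \<alpha>\<close> is an automorphism of the unitary group, twisting maps conjugate
representations to conjugate ones, and the induced map on classes, which is \<open>\<kappa>\<close>, is well defined.\<close>

lemma twist_conj:
  assumes st: "st \<in> carrier G - carrier N" and \<rho>: "\<rho> \<in> Hom N U" and u: "u \<in> carrier U"
  shows "twist st (conj_hom N U u \<rho>) = conj_hom N U (Ad_real \<alpha> u) (twist st \<rho>)"
proof -
  interpret Ad: group_hom U U "Ad_real \<alpha>"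
    by (intro group_hom.intro group_hom_axioms.intro group_U Ad_real_hom)
  have "Ad_real \<alpha> (u \<otimes>\<^bsub>U\<^esub> w \<otimes>\<^bsub>U\<^esub> inv\<^bsub>U\<^esub> u)
      = Ad_real \<alpha> u \<otimes>\<^bsub>U\<^esub> Ad_real \<alpha> w \<otimes>\<^bsub>U\<^esub> inv\<^bsub>U\<^esub> (Ad_real \<alpha> u)"
    if "w \<in> carrier U" for w
    using u that by (simp del: U_simps)
  then show ?thesis
    using HomD(1)[OF \<rho>] Ad_inv_N[OF st]
    by (simp add: conj_hom_def cong: restrict_cong del: U_simps)
qed

lemma kappa_map_cls:
  assumes st: "st \<in> carrier G - carrier N" and \<rho>: "\<rho> \<in> Hom N U"
  shows "kappa_map Xt At p \<sigma> smul h \<alpha> st (cls \<rho>) = cls (twist st \<rho>)"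
proof -
  have "\<one>\<^bsub>U\<^esub> \<in> carrier U" using group.is_monoid[OF group_U] by (rule monoid.one_closed)
  then have "cls \<rho> \<noteq> {}" by (auto simp: rep_class_def orbit_def)
  moreover have "cls (twist st \<rho>') = cls (twist st \<rho>)" if \<rho>': "\<rho>' \<in> cls \<rho>" for \<rho>'
  proof -
    obtain u where u: "u \<in> carrier U" "\<rho>' = conj_hom N U u \<rho>"
      using \<rho>' by (auto simp: rep_class_def orbit_def)
    then show ?thesis
      using twist_conj[OF st \<rho> u(1)] cls_conj[OF twist_Hom[OF st \<rho>]]
        hom_in_carrier[OF Ad_real_hom u(1)] by metis
  qed
  ultimately show ?thesis unfolding kappa_map_def by simp
qed

text \<open>This is why \<open>\<Phi>\<close> takes values in the fixed points. In \<open>G\<close>, the element \<open>g = st\<inverse> f st\<close> satisfies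
\<open>st g = f st\<close>. Let \<open>\<rho> st = (a, 1)\<close>, that is \<open>a \<circ> \<alpha>\<close>. Applying \<open>\<rho>\<close> gives
\<open>a \<circ> Ad_\<alpha> (\<rho> g) = \<rho> f \<circ> a\<close>, so the twisted representation is the original one conjugated by
the inverse of \<open>a\<close>.\<close>

lemma twist_topological_part:
  assumes st: "st \<in> carrier G - carrier N" and \<rho>: "\<rho> \<in> augHom"
  obtains a where "a \<in> carrier U"
    "twist st (topological_part \<rho>) = conj_hom N U a (topological_part \<rho>)"
proof -
  interpret U: group U by (rule group_U)
  interpret G: group G by (rule group_G)
  have st': "st \<in> carrier G" using st by simp
  have \<rho>': "\<rho> \<in> Hom G H" using \<rho> by (simp add: Hom_aug_def)
  obtain a where aU: "a \<in> carrier U" and a: "\<rho> st = (a, 1)"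
    by (rule Hom_aug_odd[OF \<rho> st])
  have "Ad_real \<alpha> (fst (\<rho> (Ad_inv G st f))) = inv\<^bsub>U\<^esub> a \<otimes>\<^bsub>U\<^esub> fst (\<rho> f) \<otimes>\<^bsub>U\<^esub> inv\<^bsub>U\<^esub> (inv\<^bsub>U\<^esub> a)"
    if f: "f \<in> carrier N" for f
  proof -
    let ?g = "Ad_inv G st f"
    have g: "?g \<in> carrier N" using Ad_inv_N[OF st f] .
    have fg: "f \<in> carrier G" "?g \<in> carrier G" using f g carrier_N_subset by auto
    have "st \<otimes>\<^bsub>G\<^esub> ?g = f \<otimes>\<^bsub>G\<^esub> st"
      using st' fg by (simp add: Ad_inv_def G.m_assoc[symmetric])
    then have "\<rho> st \<otimes>\<^bsub>H\<^esub> \<rho> ?g = \<rho> f \<otimes>\<^bsub>H\<^esub> \<rho> st"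
      using HomD(2)[OF \<rho>'] st' fg by metis
    then have "(a, 1) \<otimes>\<^bsub>H\<^esub> (fst (\<rho> ?g), 0) = (fst (\<rho> f), 0) \<otimes>\<^bsub>H\<^esub> (a, 1)"
      using a Hom_aug_N(2)[OF \<rho> f] Hom_aug_N(2)[OF \<rho> g] by metis
    then have "a \<otimes>\<^bsub>U\<^esub> Ad_real \<alpha> (fst (\<rho> ?g)) = fst (\<rho> f) \<otimes>\<^bsub>U\<^esub> a"
      by (simp add: H_simps)
    then show ?thesis
      using aU Hom_aug_N(1)[OF \<rho> f] hom_in_carrier[OF Ad_real_hom Hom_aug_N(1)[OF \<rho> g]]
      by (simp add: U.inv_solve_left U.m_assoc del: U_simps)
  qed
  then have "twist st (topological_part \<rho>) = conj_hom N U (inv\<^bsub>U\<^esub> a) (topological_part \<rho>)"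
    using Ad_inv_N[OF st] by (auto simp: conj_hom_def simp del: U_simps intro!: restrict_ext)
  then show ?thesis using that U.inv_closed[OF aU] by blast
qed

lemma Phi_map_in_Fix_kappa:
  assumes st: "st \<in> carrier G - carrier N"
  shows "Phi_map Xt At p smul h ` real_rep_space Xt At p \<sigma> smul h \<alpha>
    \<subseteq> Fix_kappa Xt At p \<sigma> smul h \<alpha> st"
proof
  fix c assume "c \<in> Phi_map Xt At p smul h ` real_rep_space Xt At p \<sigma> smul h \<alpha>"
  then obtain \<rho> where \<rho>: "\<rho> \<in> augHom"
    and "c = Phi_map Xt At p smul h (orbit U (\<lambda>u. conj_hom G H (u, 0)) \<rho>)"
    by (auto simp: real_rep_space_def orbits_def)
  then have c: "c = cls (topological_part \<rho>)" by (simp add: Phi_map_orbit)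
  note hom = topological_part_Hom[OF \<rho>]
  have "kappa_map Xt At p \<sigma> smul h \<alpha> st c = c"
    using twist_topological_part[OF st \<rho>] cls_conj[OF hom] kappa_map_cls[OF st hom] c by metis
  then show "c \<in> Fix_kappa Xt At p \<sigma> smul h \<alpha> st"
    using hom by (auto simp: Fix_kappa_def c rep_space_def orbits_def rep_class_def)
qed

end


section \<open>Plane domains as Riemann surfaces\<close>

lemma riemann_surface_plane_domain:
  assumes "open S"
  shows "riemann_surface S {(S, id :: complex \<Rightarrow> complex)}"
proof -
  have "homeomorphism S (id ` S) id id" by (simp add: homeomorphism_def)
  moreover have "(id \<circ> inv_into S id) holomorphic_on S"
    by (rule holomorphic_transform[OF holomorphic_on_ident]) (simp add: inv_into_f_eq)
  ultimately have "complex_atlas S {(S, id :: complex \<Rightarrow> complex)}"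
    using assms by (auto simp: complex_atlas_def)
  moreover have "Hausdorff_space (top_of_set S)"
    by (simp add: Hausdorff_space_subtopology)
  ultimately show ?thesis by (simp add: riemann_surface_def)
qed

text \<open>With the single chart \<open>id\<close>, the expression of \<open>f\<close> in charts is \<open>f \<circ> inv_into S id\<close>, which agrees with \<open>f\<close>
on \<open>S\<close> only. Hence \<open>P\<close> is assumed for every function that agrees with \<open>f\<close> on \<open>S\<close>.\<close>

lemma map_in_charts_plane_domain:
  assumes P: "\<And>g. (\<And>z. z \<in> S \<Longrightarrow> g z = f z) \<Longrightarrow> P S g"
    and "continuous_on S f" "f ` S \<subseteq> T"
  shows "map_in_charts P S {(S, id)} T {(T, id)} f"
proof -
  have "S \<inter> f -` T = S" using assms(3) by blast
  moreover have "P S (f \<circ> inv_into S id)"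
    by (rule P) (simp add: inv_into_f_eq)
  ultimately show ?thesis
    using assms(2,3) by (simp add: map_in_charts_def)
qed

lemma self_diffeos_plane:
  assumes f: "\<And>k. Ck_on k f UNIV" and g: "\<And>k. Ck_on k g UNIV"
    and gf: "\<And>z. g (f z) = z" and fg: "\<And>z. f (g z) = z"
  shows "f \<in> self_diffeos UNIV {(UNIV, id :: complex \<Rightarrow> complex)}"
proof -
  have smooth: "smooth_map UNIV {(UNIV, id :: complex \<Rightarrow> complex)} UNIV {(UNIV, id)} h"
    if "\<And>k. Ck_on k h UNIV" for h :: "complex \<Rightarrow> complex"
    unfolding smooth_map_def using that[of 0]
    by (intro map_in_charts_plane_domain allI Ck_on_cong[OF open_UNIV that]) auto
  have "inv_into UNIV f = g"
    by (rule inv_equality[OF gf fg])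
  moreover have "bij f"
    by (rule o_bij[of g]) (auto simp: gf fg)
  ultimately show ?thesis
    by (simp add: self_diffeos_def Bij_def smooth f g)
qed


section \<open>The antipodal map of the punctured plane\<close>

abbreviation punctured_atlas :: "complex chart set" where
  "punctured_atlas \<equiv> {(- {0}, id)}"

abbreviation plane_atlas :: "complex chart set" where
  "plane_atlas \<equiv> {(UNIV, id)}"

text \<open>The antipodal map of the Riemann sphere, restricted to the punctured plane. It has no fixed
points; this is reflected in the fact that none of its lifts is an involution.\<close>

definition antipode :: "complex \<Rightarrow> complex" where
  "antipode z = - inverse (cnj z)"

text \<open>A lift of \<^const>\<open>antipode\<close> along the exponential, as \<open>exp (\<i> \<pi>) = -1\<close>.\<close>

definition antipode_lift :: "complex \<Rightarrow> complex" where
  "antipode_lift w = \<i> * pi - cnj w"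

text \<open>The deck transformation that generates the fundamental group of the punctured plane.\<close>

abbreviation winding :: "complex \<Rightarrow> complex" where
  "winding \<equiv> \<lambda>w. w + 2 * of_real pi * \<i>"

abbreviation line_metric :: "complex \<Rightarrow> complex \<Rightarrow> complex" where
  "line_metric v w \<equiv> v * cnj w"

lemma klein_punctured_plane: "connected_klein_surface (- {0}) punctured_atlas antipode"
  unfolding connected_klein_surface_def
proof (intro conjI ballI)
  show "riemann_surface (- {0}) punctured_atlas"
    by (rule riemann_surface_plane_domain) auto
  show "connected (- {0 :: complex})"
    by (rule connected_punctured_universe) simp
  have "(\<lambda>z. cnj (antipode z)) holomorphic_on - {0}"
    unfolding antipode_def by (auto intro!: holomorphic_intros)
  then have "(\<lambda>z. cnj (g z)) holomorphic_on - {0}"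
    if "\<And>z. z \<in> - {0} \<Longrightarrow> g z = antipode z" for g
    by (rule holomorphic_transform) (simp add: that)
  moreover have "continuous_on (- {0}) antipode"
    unfolding antipode_def by (auto intro!: continuous_intros)
  ultimately show "antiholomorphic_map (- {0}) punctured_atlas (- {0}) punctured_atlas antipode"
    unfolding antiholomorphic_map_def
    by (intro map_in_charts_plane_domain) (auto simp: antipode_def)
qed (simp add: antipode_def)

lemma universal_cover_exp:
  "universal_cover UNIV plane_atlas 0 exp (- {0}) punctured_atlas 1"
  unfolding universal_cover_def
proof (intro conjI)
  show "covering_space UNIV exp (- {0 :: complex})"
    using covering_space_exp_punctured_plane by simp
  show "simply_connected (UNIV :: complex set)"
    by (simp add: convex_imp_simply_connected)
  show "riemann_surface UNIV plane_atlas"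
    by (rule riemann_surface_plane_domain) simp
  have "g holomorphic_on UNIV" if "\<And>z. z \<in> UNIV \<Longrightarrow> g z = exp z" for g :: "complex \<Rightarrow> complex"
    by (rule holomorphic_transform[OF holomorphic_on_exp]) (simp add: that)
  then show "holomorphic_map UNIV plane_atlas (- {0}) punctured_atlas exp"
    unfolding holomorphic_map_def
    by (intro map_in_charts_plane_domain) (auto intro: continuous_intros)
qed auto

lemma hermitian_line: "hermitian_space (*) line_metric"
  unfolding hermitian_space_def
proof (intro conjI allI impI exI)
  show "finite_dimensional_vector_space (*) {1 :: complex}"
    by unfold_locales
  show "Re (line_metric v v) > 0" if "v \<noteq> 0" for v
    using that by (simp add: complex_mult_cnj complex_neq_0)
qed (auto simp: algebra_simps)

lemma real_structure_line: "compatible_real_structure (*) line_metric cnj"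
  by (simp add: compatible_real_structure_def)

interpretation annulus: klein_cover_rep "- {0}" punctured_atlas antipode 1 UNIV plane_atlas 0 exp
  "(*)" line_metric cnj
  by unfold_locales (rule klein_punctured_plane universal_cover_exp hermitian_line real_structure_line)+

lemma Ck_on_antipode_lift: "Ck_on k (\<lambda>w. c - cnj w) UNIV"
proof -
  have "Ck_on k (\<lambda>w. c + - cnj w) UNIV"
    by (intro Ck_on_add Ck_on_const Ck_on_bounded_linear[of "\<lambda>w. - cnj w"]
        bounded_linear_minus bounded_linear_cnj holomorphic_on_imp_Ck_on holomorphic_on_ident open_UNIV)
  then show ?thesis by simp
qed

lemma exp_antipode_lift: "exp (antipode_lift w) = antipode (exp w)"
  by (simp add: antipode_lift_def antipode_def exp_diff exp_cnj field_simps)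

lemma antipode_lift_odd: "antipode_lift \<in> carrier annulus.G - carrier annulus.N"
proof -
  have "antipode_lift \<in> self_diffeos UNIV plane_atlas"
    unfolding antipode_lift_def
    \<comment> \<open>The inverse of \<open>w \<mapsto> c - cnj w\<close> is \<open>w \<mapsto> cnj c - cnj w\<close>.\<close>
    by (rule self_diffeos_plane[OF Ck_on_antipode_lift Ck_on_antipode_lift[of _ "- (\<i> * pi)"]]) auto
  moreover have "antipode (exp 0) \<noteq> exp (0 :: complex)"
    by (simp add: antipode_def)
  ultimately show ?thesis
    unfolding annulus.carrier_G annulus.carrier_N using exp_antipode_lift
    by (auto intro: exI[of _ "0 :: complex"])
qed

lemma antipode_lift_square:
  "antipode_lift \<otimes>\<^bsub>annulus.G\<^esub> antipode_lift = winding"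
  using antipode_lift_odd by (auto simp: annulus.mult_G compose_def antipode_lift_def)

text \<open>The difference of \<open>f\<close> and the identity is continuous with values in \<open>2 \<pi> \<i> \<int>\<close>, hence constant.\<close>

lemma deck_translation:
  assumes f: "f \<in> carrier annulus.N"
  shows "f w = w + f 0"
proof -
  have cont: "continuous_on UNIV (\<lambda>w. f w - w)"
    using f by (auto simp: annulus.carrier_N self_diffeos_def smooth_map_def map_in_charts_def
        intro: continuous_intros)
  have e: "exp (f w) = exp w" for w
    using f by (simp add: annulus.carrier_N)
  have gap: "2 * pi \<le> norm ((f v - v) - (f w - w))" if "f v - v \<noteq> f w - w" for v w
  proof -
    have "exp ((f v - v) - (f w - w)) = 1"
      by (simp add: exp_diff e)
    then obtain n :: int where n: "(f v - v) - (f w - w) = of_int n * (2 * pi) * \<i>"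
      using exp_eq[of "(f v - v) - (f w - w)" 0] by (auto simp: algebra_simps)
    with that have "n \<noteq> 0" by auto
    then have "1 \<le> \<bar>n\<bar>" by arith
    then have "1 \<le> \<bar>real_of_int n\<bar>" by (metis of_int_abs of_int_1_le_iff)
    then show ?thesis
      unfolding n by (simp add: norm_mult)
  qed
  have "(\<lambda>w. f w - w) constant_on UNIV"
  proof (rule continuous_discrete_range_constant[OF connected_UNIV cont])
    show "\<exists>e>0. \<forall>v. v \<in> UNIV \<and> f v - v \<noteq> f w - w \<longrightarrow> e \<le> norm ((f v - v) - (f w - w))" for w
      using gap by (intro exI[of _ "2 * pi"]) simp
  qed
  then obtain c where "f w - w = c" for w
    by (auto simp: constant_on_def)
  from this[of w] this[of 0] show ?thesis by (simp add: algebra_simps)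
qed

text \<open>Deck transformations are translations by purely imaginary numbers, and these commute with
\<open>w \<mapsto> \<i> \<pi> - cnj w\<close>.\<close>

lemma Ad_inv_antipode_lift:
  assumes f: "f \<in> carrier annulus.N"
  shows "Ad_inv annulus.G antipode_lift f = f"
proof -
  interpret G: group annulus.G by (rule annulus.group_G)
  have st: "antipode_lift \<in> carrier annulus.G" and f': "f \<in> carrier annulus.G"
    using antipode_lift_odd f annulus.carrier_N_subset by auto
  have "exp (f 0) = 1"
    using f by (simp add: annulus.carrier_N)
  then have "Re (f 0) = 0" by (simp add: exp_eq_1)
  then have im: "cnj (f 0) = - f 0" by (simp add: complex_eq_iff)
  have "f (antipode_lift w) = antipode_lift (f w)" for w
  proof -
    have "f (antipode_lift w) = \<i> * pi - cnj w + f 0"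
      using deck_translation[OF f, of "antipode_lift w"] by (simp add: antipode_lift_def)
    also have "\<dots> = antipode_lift (f w)"
      using im deck_translation[OF f, of w] by (simp add: antipode_lift_def algebra_simps)
    finally show ?thesis .
  qed
  then have "f \<otimes>\<^bsub>annulus.G\<^esub> antipode_lift = antipode_lift \<otimes>\<^bsub>annulus.G\<^esub> f"
    using st f' by (simp add: annulus.mult_G compose_def)
  then have "Ad_inv annulus.G antipode_lift f
      = inv\<^bsub>annulus.G\<^esub> antipode_lift \<otimes>\<^bsub>annulus.G\<^esub> (antipode_lift \<otimes>\<^bsub>annulus.G\<^esub> f)"
    using st f' by (simp add: Ad_inv_def G.m_assoc)
  then show ?thesis
    using st f' by (simp add: G.m_assoc[symmetric])
qed


section \<open>An invariant character that does not extend\<close>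

text \<open>The character of the fundamental group that sends the generator to \<open>-1\<close>: the translation by
\<open>2 \<pi> \<i> n\<close> goes to \<open>exp (\<i> \<pi> n)\<close>. The formula in terms of \<open>f 0\<close> avoids choosing \<open>n\<close>.\<close>

definition sign_rep :: "(complex \<Rightarrow> complex) \<Rightarrow> complex \<Rightarrow> complex" where
  "sign_rep = (\<lambda>f\<in>carrier annulus.N. \<lambda>v. exp (f 0 / 2) * v)"

lemma sign_rep_values:
  assumes "f \<in> carrier annulus.N"
  shows "exp (f 0 / 2) = 1 \<or> exp (f 0 / 2) = (-1 :: complex)"
proof -
  have "exp (f 0 / 2) ^ 2 = exp (f 0)"
    by (simp flip: exp_double)
  also have "\<dots> = 1"
    using assms by (simp add: annulus.carrier_N)
  finally show ?thesis by (simp add: power2_eq_1_iff)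
qed

lemma sign_rep_Hom: "sign_rep \<in> Hom annulus.N annulus.U"
proof -
  interpret N: group annulus.N by (rule annulus.group_N)
  have "(\<lambda>v. s * v) \<in> carrier annulus.U" if s: "s = 1 \<or> s = -1" for s :: complex
  proof -
    have ss: "s * s = 1" using s by auto
    have "Vector_Spaces.linear (*) (*) (\<lambda>v. s * v)"
      by unfold_locales (auto simp: algebra_simps)
    moreover have "bij (\<lambda>v. s * v)"
      by (rule o_bij[of "\<lambda>v. s * v"]) (auto simp: fun_eq_iff ss simp flip: mult.assoc)
    ultimately show ?thesis
      using s by (auto simp: annulus.U_iff)
  qed
  moreover have "exp ((f \<otimes>\<^bsub>annulus.N\<^esub> g) 0 / 2) = exp (f 0 / 2) * exp (g 0 / 2)"
    if fg: "f \<in> carrier annulus.N" "g \<in> carrier annulus.N" for f g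
  proof -
    have "(f \<otimes>\<^bsub>annulus.N\<^esub> g) 0 = g (f 0)"
      using fg[THEN subsetD[OF annulus.carrier_N_subset]]
      by (simp add: annulus.mult_N annulus.mult_G compose_def)
    also have "\<dots> = f 0 + g 0" by (rule deck_translation[OF fg(2)])
    finally show ?thesis by (simp add: add_divide_distrib exp_add)
  qed
  ultimately show ?thesis
    using sign_rep_values by (auto simp: Hom_def hom_def sign_rep_def o_def mult.assoc)
qed

text \<open>Conjugation by the lift is trivial on deck transformations, and \<^term>\<open>Ad_real cnj\<close> conjugates the
scalar by which a unitary map of the line multiplies; the scalars \<open>1\<close> and \<open>-1\<close> are real.\<close>

lemma twist_sign_rep: "annulus.twist antipode_lift sign_rep = sign_rep"
proof -
  have "Ad_real cnj (sign_rep f) = sign_rep f" if "f \<in> carrier annulus.N" for f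
    using sign_rep_values[OF that] that by (auto simp: annulus.Ad_real_eq sign_rep_def fun_eq_iff)
  then show ?thesis
    by (auto simp: fun_eq_iff Ad_inv_antipode_lift sign_rep_def)
qed

text \<open>This is the obstruction to extending a character. The winding generator is the square of the
lift of the antipodal map. If \<open>\<rho>\<close> sends the lift to \<open>a \<circ> cnj\<close>, where \<open>a\<close> multiplies by a number \<open>c\<close> of
modulus one, then it sends the generator to \<open>a \<circ> cnj \<circ> a \<circ> cnj\<close>, which multiplies by \<open>c * cnj c = 1\<close>.\<close>

lemma extended_rep_winding:
  assumes \<rho>: "\<rho> \<in> annulus.augHom"
  shows "fst (\<rho> winding) = id"
proof -
  have st: "antipode_lift \<in> carrier annulus.G" using antipode_lift_odd by simp
  have \<rho>': "\<rho> \<in> Hom annulus.G annulus.H" using \<rho> by (simp add: Hom_aug_def)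
  obtain a where aU: "a \<in> carrier annulus.U" and a: "\<rho> antipode_lift = (a, 1)"
    by (rule annulus.Hom_aug_odd[OF \<rho> antipode_lift_odd])
  interpret a: Vector_Spaces.linear "(*)" "(*)" a
    using aU by (simp add: annulus.U_iff)
  have lin: "a v = v * a 1" for v
    using a.scale[of v 1] by simp
  have "line_metric (a 1) (a 1) = line_metric 1 1"
    using aU unfolding annulus.U_iff by blast
  then have unit: "a 1 * cnj (a 1) = 1" by simp
  have "\<rho> winding = \<rho> antipode_lift \<otimes>\<^bsub>annulus.H\<^esub> \<rho> antipode_lift"
    using HomD(2)[OF \<rho>' st st] by (simp add: antipode_lift_square)
  then have "fst (\<rho> winding) = a \<circ> Ad_real cnj a"
    by (simp add: a annulus.H_simps)
  also have "\<dots> = id"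
  proof
    fix v
    have "(a \<circ> Ad_real cnj a) v = cnj (cnj v * a 1) * a 1"
      using lin by (metis annulus.Ad_real_eq comp_apply)
    also have "\<dots> = v * (a 1 * cnj (a 1))" by simp
    finally show "(a \<circ> Ad_real cnj a) v = id v" by (simp add: unit)
  qed
  finally show ?thesis .
qed

lemma winding_deck: "winding \<in> carrier annulus.N"
proof -
  have "winding \<in> self_diffeos UNIV plane_atlas"
    by (rule self_diffeos_plane[where g = "\<lambda>w. w - 2 * of_real pi * \<i>"])
      (auto intro!: holomorphic_on_imp_Ck_on holomorphic_intros)
  then show ?thesis
    by (simp add: annulus.carrier_N exp_add)
qed

text \<open>Conjugation fixes the identity, so every representative of the right-hand class sends the
generator to the identity; \<^const>\<open>sign_rep\<close> does not.\<close>

lemma sign_class_not_in_image: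
  assumes \<rho>: "\<rho> \<in> annulus.augHom"
  shows "annulus.cls sign_rep \<noteq> annulus.cls (annulus.topological_part \<rho>)"
proof
  interpret U: group annulus.U by (rule annulus.group_U)
  assume "annulus.cls sign_rep = annulus.cls (annulus.topological_part \<rho>)"
  moreover have "conj_hom annulus.N annulus.U \<one>\<^bsub>annulus.U\<^esub> sign_rep \<in> annulus.cls sign_rep"
    using U.one_closed unfolding rep_class_def orbit_def by blast
  ultimately obtain u where u: "u \<in> carrier annulus.U"
    and "conj_hom annulus.N annulus.U \<one>\<^bsub>annulus.U\<^esub> sign_rep
      = conj_hom annulus.N annulus.U u (annulus.topological_part \<rho>)"
    unfolding rep_class_def orbit_def by blast
  then have "conj_hom annulus.N annulus.U \<one>\<^bsub>annulus.U\<^esub> sign_rep winding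
      = conj_hom annulus.N annulus.U u (annulus.topological_part \<rho>) winding"
    by simp
  moreover have "conj_hom annulus.N annulus.U u (annulus.topological_part \<rho>) winding = \<one>\<^bsub>annulus.U\<^esub>"
    using U.r_inv[OF u] by (simp add: conj_hom_apply winding_deck extended_rep_winding[OF \<rho>])
  moreover have "conj_hom annulus.N annulus.U \<one>\<^bsub>annulus.U\<^esub> sign_rep winding = sign_rep winding"
    using HomD(1)[OF sign_rep_Hom winding_deck] U.inv_one
    by (simp add: conj_hom_apply winding_deck)
  ultimately have "sign_rep winding = id" by simp
  then have "sign_rep winding 1 = 1" by simp
  then show False
    by (simp add: sign_rep_def winding_deck)
qed


section \<open>The image of the restriction map\<close>

theorem theorem3p4:
  shows
    "(\<forall>(X :: 'a::topological_space set) A \<sigma> x (Xt :: 'b::topological_space set) At xt p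
        (smul :: complex \<Rightarrow> 'v \<Rightarrow> 'v::ab_group_add) h \<alpha>.
        connected_klein_surface X A \<sigma> \<longrightarrow> x \<in> X \<longrightarrow> universal_cover Xt At xt p X A x \<longrightarrow>
        hermitian_space smul h \<longrightarrow> compatible_real_structure smul h \<alpha> \<longrightarrow>
        (\<forall>st \<in> carrier (real_fundamental_group Xt At p \<sigma>) - carrier (fundamental_group Xt At p).
           Phi_map Xt At p smul h ` real_rep_space Xt At p \<sigma> smul h \<alpha>
             \<subseteq> Fix_kappa Xt At p \<sigma> smul h \<alpha> st))
     \<and>
     (\<exists>(X :: complex set) A \<sigma> x (Xt :: complex set) At xt p
        (smul :: complex \<Rightarrow> complex \<Rightarrow> complex) h \<alpha>.
        connected_klein_surface X A \<sigma> \<and> x \<in> X \<and> universal_cover Xt At xt p X A x \<and>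
        hermitian_space smul h \<and> compatible_real_structure smul h \<alpha> \<and>
        (\<exists>st \<in> carrier (real_fundamental_group Xt At p \<sigma>) - carrier (fundamental_group Xt At p).
           Phi_map Xt At p smul h ` real_rep_space Xt At p \<sigma> smul h \<alpha>
             \<subset> Fix_kappa Xt At p \<sigma> smul h \<alpha> st))"
    (is "?incl \<and> ?proper")
proof
  show ?incl
  proof (intro allI impI ballI)
    fix X :: "'a set" and A \<sigma> x and Xt :: "'b set" and At xt p
      and smul :: "complex \<Rightarrow> 'v \<Rightarrow> 'v" and h \<alpha> st
    assume "connected_klein_surface X A \<sigma>" "universal_cover Xt At xt p X A x"
      "hermitian_space smul h" "compatible_real_structure smul h \<alpha>"
    then interpret klein_cover_rep X A \<sigma> x Xt At xt p smul h \<alpha>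
      by unfold_locales
    assume "st \<in> carrier (real_fundamental_group Xt At p \<sigma>) - carrier (fundamental_group Xt At p)"
    then show "Phi_map Xt At p smul h ` real_rep_space Xt At p \<sigma> smul h \<alpha>
        \<subseteq> Fix_kappa Xt At p \<sigma> smul h \<alpha> st"
      by (rule Phi_map_in_Fix_kappa)
  qed
  let ?image = "Phi_map UNIV plane_atlas exp (*) line_metric `
    real_rep_space UNIV plane_atlas exp antipode (*) line_metric cnj"
  let ?Fix = "Fix_kappa UNIV plane_atlas exp antipode (*) line_metric cnj antipode_lift"
  have "annulus.cls sign_rep \<in> ?Fix"
    using annulus.kappa_map_cls[OF antipode_lift_odd sign_rep_Hom] sign_rep_Hom
    by (auto simp: Fix_kappa_def twist_sign_rep rep_space_def orbits_def rep_class_def)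
  moreover have "annulus.cls sign_rep \<notin> ?image"
  proof
    assume "annulus.cls sign_rep \<in> ?image"
    then obtain \<rho> where "\<rho> \<in> annulus.augHom"
      "annulus.cls sign_rep = annulus.cls (annulus.topological_part \<rho>)"
      by (auto simp: real_rep_space_def orbits_def annulus.Phi_map_orbit)
    then show False using sign_class_not_in_image by blast
  qed
  ultimately have "?image \<subset> ?Fix"
    using annulus.Phi_map_in_Fix_kappa[OF antipode_lift_odd] by blast
  moreover have "(1 :: complex) \<in> - {0}" by simp
  ultimately show ?proper
    using klein_punctured_plane universal_cover_exp hermitian_line real_structure_line
      antipode_lift_odd
    by (intro exI conjI bexI[of _ antipode_lift])
qed

end
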